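(* (a) For all $\alpha\in\hat{\mathbb{R}}$ with $1<\alpha<3$, there is no $3$-uniform $\alpha$-free binary morphism and there is no $6$-uniform $\alpha$-free binary morphism. (b) For each positive integer $k\notin\{3,6\}$ there is a complementary morphism of length $k$ that is $\alpha$-free for some $\alpha\in\hat{\mathbb{R}}$ with $1<\alpha<3$.
   Context: Words are finite or (one-sided) infinite, over the alphabet $\{0,1\}$. The complement $\overline{w}$ of a binary word $w$ is obtained by exchanging $0$ and $1$ letterwise. A factor is a contiguous sub-block. For a finite nonempty word $w$ of length $n$, an integer $p$ with $1\le p\le n$ is a period of $w$ if $w[i]=w[i+p]$ for $0\le i<n-p$; $\mathrm{per}(w)$ is the smallest period, and $\exp(w)=n/\mathrm{per}(w)$. The critical exponent $\mathrm{cexp}(w)$ of a finite or infinite word $w$ is the supremum of $\exp(x)$ over all finite nonempty factors $x$ of $w$. $\hat{\mathbb{R}}$ is the ordered set obtained from $\mathbb{R}$ by adding, for every real $\alpha$, an element $\alpha^+$ satisfying $\alpha<\alpha^+<\beta$ for all real $\beta>\alpha$. A word $w$ is $\alpha$-free (for real $\alpha$) if $\mathrm{cexp}(w)<\alpha$, and $\alpha^+$-free if $\mathrm{cexp}(w)\le\alpha$. A binary morphism $h:\{0,1\}^*\to\{0,1\}^*$ (a map with $h(xy)=h(x)h(y)$) is $\alpha$-free (for $\alpha\in\hat{\mathbb{R}}$, $\alpha>1$) if for all words $w$: $w$ $\alpha$-free implies $h(w)$ $\alpha$-free. A morphism is $k$-uniform, or of length $k$, if it maps every letter to a word of length $k$.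 A uniform binary morphism $h$ is complementary if $h(1)=\overline{h(0)}$. *)

theory Defs
  imports Complex_Main "HOL-Library.Sublist" "HOL-Library.Extended_Real"
begin

text \<open>
  The alphabet \<open>{0, 1}\<close> is \<^typ>\<open>bool\<close> (\<open>0\<close> is \<^const>\<open>False\<close>, \<open>1\<close> is \<^const>\<open>True\<close>); the words on which
  morphisms act are lists. The contiguous factors of a word are given by \<^const>\<open>sublist\<close>.
\<close>

definition complement :: "bool list \<Rightarrow> bool list" where
  "complement w = map Not w"

definition is_period :: "bool list \<Rightarrow> nat \<Rightarrow> bool" where
  "is_period w p \<longleftrightarrow> 1 \<le> p \<and> p \<le> length w \<and> (\<forall>i. i + p < length w \<longrightarrow> w ! i = w ! (i + p))"

text \<open>\<open>per\<close> and \<open>word_exp\<close> are meaningful for nonempty words only.\<close>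

definition per :: "bool list \<Rightarrow> nat" where
  "per w = (LEAST p. is_period w p)"

definition word_exp :: "bool list \<Rightarrow> real" where
  "word_exp w = real (length w) / real (per w)"

text \<open>
  The supremum is taken in the extended reals, so that the empty word, which has no nonempty
  factors, gets critical exponent \<open>-\<infinity>\<close> and is \<open>\<alpha>\<close>-free for every \<open>\<alpha>\<close>.
\<close>

definition cexp :: "bool list \<Rightarrow> ereal" where
  "cexp w = (SUP x\<in>{x. x \<noteq> [] \<and> sublist x w}. ereal (word_exp x))"

text \<open>The reals extended by an element \<open>\<alpha>\<^sup>+\<close>, here \<open>Above \<alpha>\<close>, immediately above each real \<open>\<alpha>\<close>.\<close>

datatype rhat = Exactly real | Above real

instantiation rhat :: linorder
begin

fun less_rhat :: "rhat \<Rightarrow> rhat \<Rightarrow> bool" where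
  "Exactly a < Exactly b \<longleftrightarrow> a < b"
| "Exactly a < Above b \<longleftrightarrow> a \<le> b"
| "Above a < Exactly b \<longleftrightarrow> a < b"
| "Above a < Above b \<longleftrightarrow> a < b"

definition less_eq_rhat :: "rhat \<Rightarrow> rhat \<Rightarrow> bool" where
  "x \<le> y \<longleftrightarrow> x < y \<or> x = (y :: rhat)"

instance
proof
  fix x y z :: rhat
  show "x < y \<longleftrightarrow> x \<le> y \<and> \<not> y \<le> x"
    by (cases x; cases y) (auto simp: less_eq_rhat_def)
  show "x \<le> x"
    by (simp add: less_eq_rhat_def)
  show "x \<le> y \<Longrightarrow> y \<le> z \<Longrightarrow> x \<le> z"
    by (cases x; cases y; cases z) (auto simp: less_eq_rhat_def)
  show "x \<le> y \<Longrightarrow> y \<le> x \<Longrightarrow> x = y"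
    by (cases x; cases y) (auto simp: less_eq_rhat_def)
  show "x \<le> y \<or> y \<le> x"
    by (cases x; cases y) (auto simp: less_eq_rhat_def)
qed

end

fun free_word :: "rhat \<Rightarrow> bool list \<Rightarrow> bool" where
  "free_word (Exactly a) w \<longleftrightarrow> cexp w < ereal a"
| "free_word (Above a) w \<longleftrightarrow> cexp w \<le> ereal a"

definition binary_morphism :: "(bool list \<Rightarrow> bool list) \<Rightarrow> bool" where
  "binary_morphism h \<longleftrightarrow> (\<forall>x y. h (x @ y) = h x @ h y)"

definition uniform_morphism :: "nat \<Rightarrow> (bool list \<Rightarrow> bool list) \<Rightarrow> bool" where
  "uniform_morphism k h \<longleftrightarrow> binary_morphism h \<and> (\<forall>a. length (h [a]) = k)"

definition complementary_morphism :: "(bool list \<Rightarrow> bool list) \<Rightarrow> bool" where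
  "complementary_morphism h \<longleftrightarrow>
    (\<exists>k. uniform_morphism k h) \<and> h [True] = complement (h [False])"

definition free_morphism :: "rhat \<Rightarrow> (bool list \<Rightarrow> bool list) \<Rightarrow> bool" where
  "free_morphism \<alpha> h \<longleftrightarrow> binary_morphism h \<and> (\<forall>w. free_word \<alpha> w \<longrightarrow> free_word \<alpha> (h w))"

end

theory Submission
  imports Defs
begin

text \<open>
  Freeness of a word is a statement about its runs, that is, factors together with a period
  (\<open>free_word_iff_run\<close>). What a \<open>k\<close>-uniform morphism does to the exponent of a run depends on the
  agreement of the two letter images at their ends. If they share a prefix and a suffix of total
  length \<open>c\<close>, a run of length \<open>L\<close> becomes a run of length \<open>k * L + c\<close> whose period is \<open>k\<close> times as large
  (\<open>run_concat_uniform\<close>). For a complementary morphism the images agree nowhere, so that runs whose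
  period is a multiple of \<open>k\<close> keep their exponents (\<open>run_cmorph_multiple\<close>). The first phenomenon makes
  the lengths three and six impossible, the second one makes all other lengths possible.

  Existence. Exponents close to \<open>3\<close> leave room: if the block \<open>u\<close> and its complement occur in images only
  at block boundaries, and if no image contains a cube of period less than \<open>k\<close>, then the complementary
  morphism given by \<open>u\<close> is \<open>\<alpha>\<close>-free for all real \<open>\<alpha>\<close> between \<open>3 - 1 / k\<close> and \<open>3\<close>
  (\<open>free_morphism_cmorph\<close>). Both conditions hold for blocks that contain a short marker which occurs
  nowhere else, provided that the words between consecutive markers are cube-free. The marker \<open>01010\<close>
  inserted into a Thue--Morse word has this property, since it breaks the decomposition of the word
  into the pairs \<open>01\<close> and \<open>10\<close>. This gives all odd lengths from nine on (\<open>synchronizing_block\<close>,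
  \<open>block_no_short_cube\<close>, \<open>extendable_word_exists\<close>). Composition with the Thue--Morse morphism doubles a
  length, and the lengths one, five, seven and twelve are treated directly.

  Impossibility. An \<open>\<alpha>\<close>-free morphism of length at least two forces \<open>\<alpha>\<close> above \<open>2\<close>, so that
  overlap-free words are \<open>\<alpha>\<close>-free. For the lengths three and six it suffices to look at the images of
  \<open>00\<close>, \<open>11\<close> and \<open>0110\<close>. Either one of them contains a cube, or the letter images share a prefix and a
  suffix of total length at least \<open>k / 3\<close> and some exponent is at least \<open>5 / 2\<close>. In the second case a
  run of length \<open>3 * p - 1\<close> with period \<open>p\<close>, in the middle of a word with no larger exponent, has an image
  of exponent at least \<open>3 - 2 / (3 * p)\<close>, which excludes every \<open>\<alpha>\<close> that lies above \<open>3 - 1 / p\<close> but not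
  above \<open>3 - 2 / (3 * p)\<close>. Suitable words, most of them stretches of periodic Thue--Morse words with
  periods \<open>2 ^ n\<close> and \<open>3 * 2 ^ n\<close>, exist for enough values of \<open>p\<close> to exclude everything up to \<open>3\<close>
  (\<open>critical_word_seed\<close>, \<open>wide_margin_not_free\<close>).
\<close>

section \<open>Runs and free words\<close>

text \<open>
  A run is a factor, given by its position \<open>i\<close> and its length \<open>n\<close>, with a not necessarily minimal
  period \<open>p\<close>. Positions are kept because all the arguments below compare the offset of a factor with
  the block structure of an image; non-minimal periods are harmless because they only yield smaller
  exponents.
\<close>

definition run :: "bool list \<Rightarrow> nat \<Rightarrow> nat \<Rightarrow> nat \<Rightarrow> bool" where
  "run w p i n \<longleftrightarrow> i + n \<le> length w \<and> (\<forall>j. i \<le> j \<and> j + p < i + n \<longrightarrow> w ! j = w ! (j + p))"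

lemma runD: "run w p i n \<Longrightarrow> i \<le> j \<Longrightarrow> j + p < i + n \<Longrightarrow> w ! j = w ! (j + p)"
  by (simp add: run_def)

lemma run_length: "run w p i n \<Longrightarrow> i + n \<le> length w"
  by (simp add: run_def)

lemma run_subrun: "run w p i n \<Longrightarrow> i \<le> i' \<Longrightarrow> i' + n' \<le> i + n \<Longrightarrow> run w p i' n'"
  by (auto simp: run_def)

lemma run_infix:
  assumes "run (xs @ ys @ zs) p (length xs + i) n" "i + n \<le> length ys"
  shows "run ys p i n"
  unfolding run_def
proof (intro conjI allI impI)
  fix j assume j: "i \<le> j \<and> j + p < i + n"
  have "(xs @ ys @ zs) ! (length xs + j) = (xs @ ys @ zs) ! (length xs + j + p)"
    by (rule runD[OF assms(1)]) (use j in auto)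
  then show "ys ! j = ys ! (j + p)"
    using j assms(2) by (simp add: nth_append add.assoc)
qed (fact assms(2))

lemma run_append_iff:
  assumes "i + n \<le> length ys"
  shows "run (xs @ ys @ zs) p (length xs + i) n \<longleftrightarrow> run ys p i n"
proof
  assume r: "run ys p i n"
  show "run (xs @ ys @ zs) p (length xs + i) n"
    unfolding run_def
  proof (intro conjI allI impI)
    fix j assume j: "length xs + i \<le> j \<and> j + p < length xs + i + n"
    then obtain l where l: "j = length xs + l" by (metis le_Suc_ex add.assoc)
    have "ys ! l = ys ! (l + p)" using j l by (intro runD[OF r]) auto
    then show "(xs @ ys @ zs) ! j = (xs @ ys @ zs) ! (j + p)"
      using j assms l by (simp add: nth_append add.assoc)
  qed (use assms in simp)
qed (use run_infix assms in blast)

lemma run_map_Not: "run (map Not w) p i n \<longleftrightarrow> run w p i n"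
  unfolding run_def by (auto simp: nth_map)

lemma is_period_imp_run:
  assumes "is_period x p" shows "run (ys @ x @ zs) p (length ys) (length x)"
proof -
  have "run x p 0 (length x)" using assms by (auto simp: run_def is_period_def)
  then show ?thesis using run_append_iff[of 0 "length x" x ys zs p] by simp
qed

lemma run_imp_is_period:
  assumes "run w p i n" "1 \<le> p" "p \<le> n"
  shows "is_period (take n (drop i w)) p"
  using assms unfolding is_period_def run_def by (auto simp: add.assoc min_def)

lemma is_period_per: "x \<noteq> [] \<Longrightarrow> is_period x (per x)"
  unfolding per_def by (rule LeastI[of _ "length x"]) (auto simp: is_period_def Suc_le_eq)

lemma Exactly_less_mono: "Exactly y < \<alpha> \<Longrightarrow> x \<le> y \<Longrightarrow> Exactly x < \<alpha>"
  by (cases \<alpha>) auto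

lemma finite_nonempty_factors: "finite {x. x \<noteq> [] \<and> sublist x w}"
  by (rule finite_subset[of _ "set (sublists w)"]) auto

lemma free_word_iff_word_exp:
  "free_word \<alpha> w \<longleftrightarrow> (\<forall>x. x \<noteq> [] \<and> sublist x w \<longrightarrow> Exactly (word_exp x) < \<alpha>)"
proof -
  let ?S = "{x. x \<noteq> [] \<and> sublist x w}"
  show ?thesis
  proof (cases \<alpha>)
    case (Exactly a)
    have "cexp w < ereal a \<longleftrightarrow> (\<forall>x\<in>?S. word_exp x < a)"
    proof (cases "?S = {}")
      case True
      then show ?thesis by (simp only: cexp_def) (simp add: bot_ereal_def)
    next
      case False
      then show ?thesis unfolding cexp_def
        by (subst finite_Sup_less_iff) (use finite_nonempty_factors in auto)
    qed
    then show ?thesis using Exactly by auto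
  next
    case (Above a)
    then show ?thesis by (auto simp: cexp_def SUP_le_iff)
  qed
qed

text \<open>
  A word has finitely many factors, so its critical exponent is attained, and both kinds of freeness
  become the same condition \<open>Exactly x < \<alpha>\<close> on the exponents \<open>x\<close> that occur.
\<close>

lemma free_word_iff_run:
  "free_word \<alpha> w \<longleftrightarrow>
    (\<forall>p i n. 1 \<le> p \<and> p \<le> n \<and> run w p i n \<longrightarrow> Exactly (real n / real p) < \<alpha>)"
  unfolding free_word_iff_word_exp
proof safe
  fix p i n assume *: "\<forall>x. x \<noteq> [] \<and> sublist x w \<longrightarrow> Exactly (word_exp x) < \<alpha>"
    and r: "1 \<le> p" "p \<le> n" "run w p i n"
  define x where "x = take n (drop i w)"
  have "is_period x p" unfolding x_def by (rule run_imp_is_period) (use r in auto)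
  then have "per x \<le> p" unfolding per_def by (rule Least_le)
  have len: "length x = n" using r by (auto simp: x_def run_def)
  then have "x \<noteq> []" using r by auto
  have "sublist x w" unfolding x_def sublist_def by (metis append_take_drop_id)
  have "1 \<le> per x" using is_period_per[OF \<open>x \<noteq> []\<close>] by (simp add: is_period_def)
  then have "real n / real p \<le> word_exp x"
    unfolding word_exp_def len using \<open>per x \<le> p\<close> by (intro divide_left_mono) auto
  then show "Exactly (real n / real p) < \<alpha>"
    using * \<open>x \<noteq> []\<close> \<open>sublist x w\<close> Exactly_less_mono by blast
next
  fix x assume *: "\<forall>p i n. 1 \<le> p \<and> p \<le> n \<and> run w p i n \<longrightarrow> Exactly (real n / real p) < \<alpha>"
    and x: "x \<noteq> []" "sublist x w"
  obtain ys zs where w: "w = ys @ x @ zs" using x by (auto simp: sublist_def)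
  have "is_period x (per x)" by (rule is_period_per) fact
  then show "Exactly (word_exp x) < \<alpha>"
    using * is_period_imp_run[of x "per x" ys zs] unfolding w word_exp_def
    by (auto simp: is_period_def)
qed

lemma free_wordD:
  "free_word \<alpha> w \<Longrightarrow> run w p i n \<Longrightarrow> 1 \<le> p \<Longrightarrow> p \<le> n \<Longrightarrow> Exactly (real n / real p) < \<alpha>"
  unfolding free_word_iff_run by blast

definition cube_free :: "bool list \<Rightarrow> bool" where
  "cube_free w \<longleftrightarrow> (\<forall>p i. 0 < p \<longrightarrow> \<not> run w p i (3 * p))"

definition overlap_free :: "bool list \<Rightarrow> bool" where
  "overlap_free w \<longleftrightarrow> (\<forall>p i. 0 < p \<longrightarrow> \<not> run w p i (2 * p + 1))"

lemma overlap_free_sublist: "overlap_free w \<Longrightarrow> sublist x w \<Longrightarrow> overlap_free x"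
  unfolding overlap_free_def sublist_def
  by (metis run_append_iff run_length)

lemma cube_free_map_Not: "cube_free (map Not w) \<longleftrightarrow> cube_free w"
  by (simp add: cube_free_def run_map_Not)

section \<open>Uniform morphisms\<close>

lemma length_concat_uniform:
  "(\<And>b. length (g b) = k) \<Longrightarrow> length (concat (map g w)) = k * length w"
  by (induction w) auto

lemma nth_concat_uniform:
  assumes "\<And>b. length (g b) = k" "t < k * length w"
  shows "concat (map g w) ! t = g (w ! (t div k)) ! (t mod k)"
  using assms(2)
proof (induction w arbitrary: t)
  case (Cons b w)
  show ?case
  proof (cases "t < k")
    case True
    then show ?thesis by (simp add: nth_append assms(1))
  next
    case False
    have "k > 0" using Cons.prems by (cases k) auto
    have "concat (map g w) ! (t - k) = g (w ! ((t - k) div k)) ! ((t - k) mod k)"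
      by (rule Cons.IH) (use Cons.prems False in auto)
    moreover have "t div k = Suc ((t - k) div k)" "(t - k) mod k = t mod k"
      using False \<open>k > 0\<close> by (auto simp: le_div_geq le_mod_geq)
    ultimately show ?thesis using False by (simp add: nth_append assms(1))
  qed
qed simp

lemma binary_morphism_eq_concat:
  assumes "binary_morphism h" shows "h w = concat (map (\<lambda>b. h [b]) w)"
proof (induction w)
  case Nil
  have "h ([] @ []) = h [] @ h []" using assms unfolding binary_morphism_def by blast
  then show ?case by simp
next
  case (Cons b w)
  have "h ([b] @ w) = h [b] @ h w" using assms unfolding binary_morphism_def by blast
  then show ?case using Cons by simp
qed

text \<open>
  If the images of the two letters share a prefix of length \<open>a\<close> and a suffix of length \<open>s\<close>, then the
  image of a run extends by \<open>s\<close> letters to the left and by \<open>a\<close> letters to the right, whatever the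
  letters next to the run are. So such a morphism increases exponents. The bounds on \<open>i\<close> and \<open>i + n\<close>
  say that these neighbouring letters exist when they are needed.
\<close>

lemma run_concat_uniform:
  assumes len: "\<And>b. length (g b) = k" and r: "run w p i n" and "0 < k"
    and pre: "\<And>l b c. l < a \<Longrightarrow> g b ! l = g c ! l" and suf: "\<And>l b c. k - s \<le> l \<Longrightarrow> l < k \<Longrightarrow> g b ! l = g c ! l"
    and "a \<le> k" "s \<le> k" "s \<le> k * i" "k * (i + n) + a \<le> k * length w" 
  shows "run (concat (map g w)) (k * p) (k * i - s) (k * n + a + s)"
  unfolding run_def length_concat_uniform[OF len]
proof (intro conjI allI impI)
  show "k * i - s + (k * n + a + s) \<le> k * length w" using assms by (simp add: algebra_simps)
  fix t assume t: "k * i - s \<le> t \<and> t + k * p < k * i - s + (k * n + a + s)"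
  define j where "j = t div k"
  define r where "r = t mod k"
  have tjr: "t = k * j + r" "r < k" using \<open>0 < k\<close> by (auto simp: j_def r_def)
  have div: "(t + k * p) div k = j + p" "(t + k * p) mod k = r"
    using \<open>0 < k\<close> by (auto simp: j_def r_def)
  have bnd: "t + k * p < k * length w" "t < k * length w" using t assms by (auto simp: algebra_simps)
  have "g (w ! j) ! r = g (w ! (j + p)) ! r"
  proof (cases "i \<le> j \<and> j + p < i + n")
    case True
    then show ?thesis using runD[OF \<open>run w p i n\<close>] by simp
  next
    case False
    have "r < a \<or> k - s \<le> r"
    proof (rule ccontr)
      assume "\<not> (r < a \<or> k - s \<le> r)"
      then have ra: "a \<le> r" "r + s < k" by auto
      have "k * i \<le> k * j + r + s" using t tjr assms(8) by linarith
      also have "\<dots> < k * (j + 1)" using ra by simp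
      finally have "i \<le> j" by (metis add.commute le_Suc_eq less_Suc_eq_le linorder_not_less mult_le_mono2 plus_1_eq_Suc)
      moreover have "k * (j + p) < k * (i + n)"
        using t tjr ra assms(8) by (simp add: algebra_simps)
      then have "j + p < i + n" by simp
      ultimately show False using False by simp
    qed
    then show ?thesis using pre suf tjr by blast
  qed
  then show "concat (map g w) ! t = concat (map g w) ! (t + k * p)"
    by (simp add: nth_concat_uniform[OF len bnd(1)] nth_concat_uniform[OF len bnd(2)] div
        flip: j_def r_def)
qed

section \<open>Complementary morphisms\<close>

definition cmorph :: "bool list \<Rightarrow> bool list \<Rightarrow> bool list" where
  "cmorph u w = concat (map (\<lambda>b. map ((\<noteq>) b) u) w)"

lemma length_cmorph [simp]: "length (cmorph u w) = length u * length w"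
  unfolding cmorph_def by (rule length_concat_uniform) simp

lemma cmorph_append [simp]: "cmorph u (v @ w) = cmorph u v @ cmorph u w"
  by (simp add: cmorph_def)

lemma cmorph_Nil [simp]: "cmorph u [] = []"
  by (simp add: cmorph_def)

lemma cmorph_Cons: "cmorph u (b # w) = map ((\<noteq>) b) u @ cmorph u w"
  by (simp add: cmorph_def)

lemma nth_cmorph:
  "t < length u * length w \<Longrightarrow> cmorph u w ! t = (w ! (t div length u) \<noteq> u ! (t mod length u))"
  unfolding cmorph_def
  by (subst nth_concat_uniform[of _ "length u"]) (auto intro!: nth_map mod_less_divisor)

lemma cmorph_map_Not: "cmorph u (map Not w) = map Not (cmorph u w)"
  by (induction w) (auto simp: cmorph_Cons)

lemma uniform_cmorph: "uniform_morphism (length u) (cmorph u)"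
  by (simp add: uniform_morphism_def binary_morphism_def)

lemma complementary_cmorph: "complementary_morphism (cmorph u)"
  using uniform_cmorph by (auto simp: complementary_morphism_def complement_def cmorph_Cons)

text \<open>
  The images of the two letters differ at every position, so a single equality between two positions
  at the same offset of two blocks forces the two letters to be equal. A run in the image whose period
  is a multiple of the block length therefore comes from a run in the preimage that covers it: no
  exponent is gained at the ends.
\<close>

lemma run_cmorph_multiple:
  assumes r: "run (cmorph u w) (length u * p) i n" and "length u * p < n"
  obtains j m where "run w p j m" "p < m" "n \<le> length u * m"
proof -
  define k where "k = length u"
  have bnd: "i + n \<le> k * length w" using run_length[OF r] by (simp add: k_def)
  have "0 < k" using bnd assms(2) by (cases k) auto
  define l where "l = i + n - k * p - 1"
  have l: "i \<le> l" "l + k * p + 1 = i + n" using assms(2) by (auto simp: l_def k_def)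
  define j0 where "j0 = i div k"
  define j1 where "j1 = l div k"
  have "j0 \<le> j1" unfolding j0_def j1_def by (rule div_le_mono) (rule l)
  have jb: "k * j0 \<le> i" "l < k * j1 + k" "k * j1 \<le> l"
    using dividend_less_times_div[OF \<open>0 < k\<close>, of l] unfolding j0_def j1_def by auto
  have "k * (j1 + p) < k * length w" using jb l bnd by (simp add: algebra_simps)
  then have j1p: "j1 + p < length w" by simp
  have eq: "w ! j = w ! (j + p)" if j: "j0 \<le> j" "j \<le> j1" for j
  proof -
    define t where "t = max i (k * j)"
    have "k * j \<le> l" by (rule le_trans[OF mult_le_mono2[OF j(2)] jb(3)])
    have "i < k * j0 + k"
      using dividend_less_times_div[OF \<open>0 < k\<close>, of i] unfolding j0_def by simp
    also have "\<dots> \<le> k * j + k" using j by simp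
    finally have "i < k * j + k" .
    then have t: "i \<le> t" "k * j \<le> t" "t < k * j + k" "t \<le> l"
      using l jb \<open>k * j \<le> l\<close> \<open>0 < k\<close> by (auto simp: t_def)
    have "cmorph u w ! t = cmorph u w ! (t + k * p)"
      unfolding k_def by (rule runD[OF r]) (use t l in \<open>auto simp: k_def\<close>)
    moreover have "t div k = j" using t by (intro div_nat_eqI) (auto simp: algebra_simps)
    moreover have "t + k * p < k * length w" using t l bnd by simp
    ultimately show ?thesis using \<open>0 < k\<close> by (auto simp: nth_cmorph add.commute simp flip: k_def) 
  qed
  have "run w p j0 (j1 - j0 + 1 + p)"
    unfolding run_def using \<open>j0 \<le> j1\<close> j1p eq by auto
  moreover have "n \<le> k * (j1 - j0 + 1 + p)"
  proof -
    have "k * (j1 - j0) + k * j0 = k * j1" using \<open>j0 \<le> j1\<close> by (metis add_mult_distrib2 le_add_diff_inverse2)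
    then have "n \<le> k * (j1 - j0) + k + k * p" using jb l by linarith
    then show ?thesis by (simp add: algebra_simps)
  qed
  ultimately show ?thesis using that unfolding k_def by simp
qed

text \<open>
  The block \<open>u\<close> and its complement occur in images only at block boundaries.
\<close>

definition synchronizing :: "bool list \<Rightarrow> bool" where
  "synchronizing u \<longleftrightarrow> (\<forall>a b c r. 0 < r \<and> r < length u \<longrightarrow>
     take (length u) (drop r (cmorph u [a, b])) \<noteq> cmorph u [c])"

lemma drop_cmorph: "drop (length u * j) (cmorph u w) = cmorph u (drop j w)"
proof (cases "j \<le> length w")
  case True
  have "drop (length u * j) (cmorph u (take j w) @ cmorph u (drop j w)) = cmorph u (drop j w)"
    using True by simp
  then show ?thesis by (simp flip: cmorph_append)
next
  case False
  then show ?thesis by simp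
qed

lemma take_cmorph: "take (length u * j) (cmorph u w) = cmorph u (take j w)"
proof (cases "j \<le> length w")
  case True
  have "take (length u * j) (cmorph u (take j w) @ cmorph u (drop j w)) = cmorph u (take j w)"
    using True by simp
  then show ?thesis by (simp flip: cmorph_append)
next
  case False
  then show ?thesis by simp
qed

lemma synchronizingD:
  assumes "synchronizing u" and "t + length u \<le> length u * length w" and "j < length w"
    and eq: "\<And>i. i < length u \<Longrightarrow> cmorph u w ! (t + i) = cmorph u w ! (length u * j + i)"
  shows "length u dvd t"
proof (rule ccontr)
  assume ndvd: "\<not> length u dvd t"
  define k where "k = length u"
  have "0 < k" using assms(2) ndvd by (cases "k = 0") (auto simp: k_def)
  define l where "l = t div k"
  define r where "r = t mod k"
  have tlr: "t = k * l + r" "r < k" "0 < r"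
    using \<open>0 < k\<close> ndvd by (auto simp: l_def r_def k_def mod_greater_zero_iff_not_dvd)
  have "k * (l + 1) < k * length w"
    using assms(2) tlr by (simp add: k_def[symmetric] algebra_simps)
  then have l: "l + 1 < length w" by (metis mult_less_cancel1)
  have "drop l w = w ! l # w ! (l + 1) # drop (l + 2) w"
    using l by (simp add: Cons_nth_drop_Suc)
  then have "take 2 (drop l w) = [w ! l, w ! (l + 1)]" by simp
  moreover have "cmorph u (take 2 (drop l w)) = take (k * 2) (drop (k * l) (cmorph u w))"
    by (simp add: drop_cmorph take_cmorph k_def)
  ultimately have blk: "cmorph u [w ! l, w ! (l + 1)] = take (k * 2) (drop (k * l) (cmorph u w))" by simp
  have "take k (drop r (cmorph u [w ! l, w ! (l + 1)])) = cmorph u [w ! j]"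
  proof (rule nth_equalityI)
    show len: "length (take k (drop r (cmorph u [w ! l, w ! (l + 1)]))) = length (cmorph u [w ! j])"
      using tlr by (simp add: k_def)
    fix i assume "i < length (take k (drop r (cmorph u [w ! l, w ! (l + 1)])))"
    then have i: "i < k" by simp
    have "take k (drop r (cmorph u [w ! l, w ! (l + 1)])) ! i = cmorph u w ! (t + i)"
      unfolding blk using i tlr l assms(2) by (simp add: k_def[symmetric] add.assoc)
    also have "\<dots> = cmorph u w ! (k * j + i)" using eq i by (simp add: k_def)
    also have "\<dots> = (w ! j \<noteq> u ! i)"
    proof -
      have "k * (j + 1) \<le> k * length w" using assms(3) by (intro mult_le_mono2) simp
      then have "k * j + i < k * length w" using i by simp
      then show ?thesis using i \<open>0 < k\<close> by (simp add: nth_cmorph flip: k_def)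
    qed
    also have "\<dots> = cmorph u [w ! j] ! i" using i by (simp add: cmorph_Cons k_def)
    finally show "take k (drop r (cmorph u [w ! l, w ! (l + 1)])) ! i = cmorph u [w ! j] ! i" .
  qed
  then show False using assms(1) tlr unfolding synchronizing_def k_def by blast
qed

text \<open>
  For exponents close to \<open>3\<close> only short cubes can spoil a synchronizing complementary morphism. Runs
  whose period is a multiple of \<open>k = length u\<close> keep the exponent that they have in the preimage. A run
  of exponent at least \<open>3 - 1 / k\<close> with period \<open>q > k\<close> is so long that it contains a whole block
  together with its copy \<open>q\<close> positions later, and synchronization makes \<open>q\<close> a multiple of \<open>k\<close>. For
  \<open>q < k\<close> the length is an integer above \<open>3 * q - 1\<close>, so the run contains a cube.
\<close>

lemma free_morphism_cmorph:
  assumes sync: "synchronizing u" and "u \<noteq> []"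
    and short: "\<And>w q i. 0 < q \<Longrightarrow> q < length u \<Longrightarrow> \<not> run (cmorph u w) q i (3 * q)"
    and a: "3 - 1 / real (length u) \<le> a" 
  shows "free_morphism (Exactly a) (cmorph u)"
  unfolding free_morphism_def
proof (intro conjI allI impI)
  show "binary_morphism (cmorph u)" by (simp add: binary_morphism_def)
  fix w assume w: "free_word (Exactly a) w"
  define k where "k = length u"
  have "0 < k" using \<open>u \<noteq> []\<close> by (simp add: k_def)
  show "free_word (Exactly a) (cmorph u w)"
    unfolding free_word_iff_run
  proof (intro allI impI, rule ccontr)
    fix q i n assume qn: "1 \<le> q \<and> q \<le> n \<and> run (cmorph u w) q i n"
      and "\<not> Exactly (real n / real q) < Exactly a"
    then have na: "a * real q \<le> real n" by (simp add: field_simps)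
    have r: "run (cmorph u w) q i n" using qn by simp
    have bnd: "i + n \<le> k * length w" using run_length[OF r] by (simp add: k_def)
    have "(3 - 1 / real k) * real q \<le> real n"
      using na a mult_right_mono[OF a, of "real q"] by (simp add: k_def)
    then have "(3 * real k - 1) * real q \<le> real k * real n"
      using \<open>0 < k\<close> by (simp add: field_simps)
    then have "real (3 * k * q) \<le> real (k * n + q)" by (simp add: algebra_simps)
    then have nk: "3 * k * q \<le> k * n + q" by linarith
    show False
    proof (cases "k dvd q")
      case True
      then obtain p where p: "q = k * p" by blast
      have "0 < p" using qn p by (cases p) auto
      have "k * p < n"
      proof (rule ccontr)
        assume "\<not> k * p < n"
        then have "k * n \<le> k * q" using p by (intro mult_le_mono2) simp
        moreover have "k * q \<ge> q" "0 < k * q" using \<open>0 < k\<close> qn by simp_all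
        moreover have "3 * (k * q) \<le> k * n + q" using nk by (simp only: mult.assoc)
        ultimately show False by linarith
      qed
      then obtain j m where m: "run w p j m" "p < m" "n \<le> k * m"
        using run_cmorph_multiple[of u w p i n] r p by (metis k_def)
      have "Exactly (real m / real p) < Exactly a"
        by (rule free_wordD[OF w m(1)]) (use m \<open>0 < p\<close> in auto)
      then have "real m < a * real p" using \<open>0 < p\<close> by (simp add: field_simps)
      then have "real k * real m < real k * (a * real p)" using \<open>0 < k\<close> by simp
      also have "\<dots> \<le> real n" using na p by (simp add: algebra_simps)
      also have "\<dots> \<le> real k * real m" using m(3) by (metis of_nat_le_iff of_nat_mult)
      finally show False by simp
    next
      case ndvd: False
      show False
      proof (cases "q < k")
        case True
        have "3 * q \<le> n"
        proof (rule ccontr)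
          assume "\<not> 3 * q \<le> n"
          then have "k * (n + 1) \<le> k * (3 * q)" by (intro mult_le_mono2) simp
          then show False using nk True by (simp add: algebra_simps)
        qed
        then have "run (cmorph u w) q i (3 * q)" by (intro run_subrun[OF r]) auto
        then show False using short qn True by (simp add: k_def)
      next
        case False
        have "q \<noteq> k" using ndvd by auto
        then have "k + 1 \<le> q" using False by simp
        \<comment> \<open>The overlap of the run with its shift by one period contains a full block.\<close>
        have "2 * k \<le> n - q + 1"
        proof (rule ccontr)
          assume "\<not> 2 * k \<le> n - q + 1"
          then have "k * (n + 2) \<le> k * (2 * k + q)" using qn by (intro mult_le_mono2) simp
          then have "3 * k * q + 2 * k \<le> 2 * k * k + k * q + q" using nk by (simp add: algebra_simps)
          then have "2 * k * q + 2 * k \<le> 2 * k * k + q" by (simp add: algebra_simps)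
          moreover obtain d where "q = k + 1 + d" using \<open>k + 1 \<le> q\<close> le_Suc_ex by blast
          ultimately have "k * 3 + d * (k * 2) \<le> d + 1" by (simp add: algebra_simps)
          moreover have "d * 1 \<le> d * (k * 2)" using \<open>0 < k\<close> by (intro mult_le_mono2) simp
          ultimately show False using \<open>0 < k\<close> by linarith
        qed
        define j where "j = (i + k - 1) div k"
        have "i + k - 1 < k * j + k" "k * j \<le> i + k - 1"
          unfolding j_def using dividend_less_times_div[OF \<open>0 < k\<close>, of "i + k - 1"] by simp_all
        then have j: "i \<le> k * j" "k * j + 1 \<le> i + k" using \<open>0 < k\<close> by linarith+
        have fit: "k * j + k + q \<le> i + n" using j \<open>2 * k \<le> n - q + 1\<close> qn by linarith
        have "k * j < k * length w" using fit bnd \<open>0 < k\<close> by linarith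
        then have "j < length w" by simp
        have "k dvd k * j + q"
          unfolding k_def
        proof (rule synchronizingD[OF sync _ \<open>j < length w\<close>])
          show "length u * j + q + length u \<le> length u * length w"
            using fit bnd by (simp add: k_def)
          fix l assume "l < length u"
          then have "cmorph u w ! (k * j + l) = cmorph u w ! (k * j + l + q)"
            by (intro runD[OF r]) (use j fit in \<open>auto simp: k_def\<close>)
          then show "cmorph u w ! (length u * j + q + l) = cmorph u w ! (length u * j + l)"
            by (simp add: k_def algebra_simps)
        qed
        then show False using ndvd by (simp add: dvd_add_right_iff)
      qed
    qed
  qed
qed

section \<open>The Thue--Morse morphism\<close>

definition tm :: "bool list \<Rightarrow> bool list" where
  "tm = cmorph [False, True]"

lemma tm_append [simp]: "tm (v @ w) = tm v @ tm w"
  by (simp add: tm_def)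

lemma tm_Cons: "tm (b # w) = b # (\<not> b) # tm w"
  by (simp add: tm_def cmorph_Cons)

lemma tm_Nil [simp]: "tm [] = []"
  by (simp add: tm_def)

lemma length_tm [simp]: "length (tm w) = 2 * length w"
  by (simp add: tm_def)

lemma tm_map_Not: "tm (map Not w) = map Not (tm w)"
  by (simp add: tm_def cmorph_map_Not)

lemma nth_tm_double:
  "j < length w \<Longrightarrow> tm w ! (2 * j) = w ! j \<and> tm w ! Suc (2 * j) = (\<not> w ! j)"
proof (induction w arbitrary: j)
  case (Cons b w)
  then show ?case by (cases j) (auto simp: tm_Cons)
qed simp

lemma nth_tm_Suc:
  assumes "even t" "t < 2 * length w"
  shows "tm w ! Suc t = (\<not> tm w ! t)"
proof -
  obtain j where "t = 2 * j" using assms by blast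
  then show ?thesis using nth_tm_double[of j w] assms by simp
qed

text \<open>
  In \<open>tm w\<close> the letters at positions \<open>2 * j\<close> and \<open>2 * j + 1\<close> differ. An odd period transports this to
  the other adjacent pairs, so the letters of the run alternate throughout, which contradicts an odd
  period.
\<close>

lemma tm_no_odd_run:
  assumes r: "run (tm w) q i n" and "odd q" "2 * q < n"
  shows False
proof -
  let ?H = "tm w"
  have bnd: "i + n \<le> 2 * length w" using run_length[OF r] by simp
  have alt: "?H ! Suc t = (\<not> ?H ! t)" if t: "i \<le> t" "Suc t < i + n" for t
  proof (cases "even t")
    case True
    then show ?thesis using nth_tm_Suc bnd t by simp
  next
    case odd: False
    show ?thesis
    proof (cases "Suc t + q < i + n")
      case True
      have "?H ! t = ?H ! (t + q)" "?H ! Suc t = ?H ! (Suc t + q)"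
        using runD[OF r] t True by auto
      moreover have "?H ! Suc (t + q) = (\<not> ?H ! (t + q))"
        using nth_tm_Suc[of "t + q" w] odd \<open>odd q\<close> bnd True by simp
      ultimately show ?thesis by simp
    next
      case False
      define s where "s = t - q"
      have s: "t = s + q" "i \<le> s" using False assms(3) by (auto simp: s_def)
      have "?H ! s = ?H ! (s + q)" "?H ! Suc s = ?H ! (Suc s + q)"
        using runD[OF r, of s] runD[OF r, of "Suc s"] t s by auto
      moreover have "?H ! Suc s = (\<not> ?H ! s)"
        using nth_tm_Suc[of s w] odd \<open>odd q\<close> bnd t s by simp
      ultimately show ?thesis using s by simp
    qed
  qed
  have "?H ! (i + j) = (?H ! i \<noteq> odd j)" if "j < n" for j
    using that
  proof (induction j)
    case (Suc j)
    then show ?case using alt[of "i + j"] by simp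
  qed simp
  from this[of q] have "?H ! (i + q) \<noteq> ?H ! i" using assms by simp
  moreover have "?H ! i = ?H ! (i + q)" using runD[OF r, of i] assms by simp
  ultimately show False by simp
qed

text \<open>
  Beyond exponent two, every run of \<open>tm w\<close> lies in the image of a run of \<open>w\<close>. This is why \<open>tm\<close>
  preserves \<open>\<alpha>\<close>-freeness for \<open>\<alpha> > 2\<close>, cube-freeness and overlap-freeness.
\<close>

lemma run_tm_obtain:
  assumes r: "run (tm w) q i n" and "2 * q < n"
  obtains p j m where "q = 2 * p" "run w p j m" "p < m" "n \<le> 2 * m"
proof -
  have "even q" using tm_no_odd_run[OF r] assms by blast
  then obtain p where p: "q = 2 * p" by blast
  have len: "length [False, True] = 2" by simp
  have "run (cmorph [False, True] w) (2 * p) i n" using r p by (simp only: tm_def)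
  moreover have "2 * p < n" using p assms(2) by simp
  ultimately obtain j m where "run w p j m" "p < m" "n \<le> 2 * m"
    using run_cmorph_multiple[of "[False, True]" w p i n, unfolded len] by blast
  then show ?thesis using p that by blast
qed

lemma free_morphism_tm:
  assumes "2 < a" shows "free_morphism (Exactly a) tm"
  unfolding free_morphism_def
proof (intro conjI allI impI)
  show "binary_morphism tm" by (simp add: binary_morphism_def)
  fix w assume w: "free_word (Exactly a) w"
  show "free_word (Exactly a) (tm w)"
    unfolding free_word_iff_run
  proof (intro allI impI, rule ccontr)
    fix q i n assume qn: "1 \<le> q \<and> q \<le> n \<and> run (tm w) q i n"
      and "\<not> Exactly (real n / real q) < Exactly a"
    then have na: "a * real q \<le> real n" by (simp add: field_simps)
    moreover have "2 * real q < a * real q" using \<open>2 < a\<close> qn by simp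
    ultimately have "2 * q < n" by linarith
    then obtain p j m where m: "q = 2 * p" "run w p j m" "p < m" "n \<le> 2 * m"
      using run_tm_obtain qn by metis
    have "0 < p" using m qn by simp
    have "Exactly (real m / real p) < Exactly a"
      by (rule free_wordD[OF w m(2)]) (use m \<open>0 < p\<close> in auto)
    then have "real m < a * real p" using \<open>0 < p\<close> by (simp add: field_simps)
    then show False using na m by simp
  qed
qed

lemma tm_cube_free:
  assumes "cube_free w" shows "cube_free (tm w)"
  unfolding cube_free_def
proof (intro allI impI notI)
  fix q i :: nat assume "0 < q" "run (tm w) q i (3 * q)"
  then obtain p j m where m: "q = 2 * p" "run w p j m" "p < m" "3 * q \<le> 2 * m"
    using run_tm_obtain[of w q i "3 * q"] by auto
  then have "run w p j (3 * p)" by (intro run_subrun[OF m(2)]) auto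
  then show False using assms m \<open>0 < q\<close> by (simp add: cube_free_def)
qed

lemma tm_no_overlap_run:
  assumes "\<And>p i. 0 < p \<Longrightarrow> p < P \<Longrightarrow> \<not> run w p i (2 * p + 1)" "0 < q" "q < 2 * P"
  shows "\<not> run (tm w) q i (2 * q + 1)"
proof
  assume "run (tm w) q i (2 * q + 1)"
  then obtain p j m where m: "q = 2 * p" "run w p j m" "p < m" "2 * q + 1 \<le> 2 * m"
    using run_tm_obtain[of w q i "2 * q + 1"] by auto
  then have "run w p j (2 * p + 1)" by (intro run_subrun[OF m(2)]) auto
  then show False using assms m by simp
qed

lemma tm_overlap_free:
  assumes "overlap_free w" shows "overlap_free (tm w)"
  unfolding overlap_free_def
proof (intro allI impI)
  fix q i :: nat assume "0 < q"
  show "\<not> run (tm w) q i (2 * q + 1)"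
    by (rule tm_no_overlap_run[of q]) (use assms \<open>0 < q\<close> in \<open>auto simp: overlap_free_def\<close>)
qed

section \<open>Blocks with a marker\<close>

text \<open>
  The block of odd length \<open>2 * n + 9\<close> is a Thue--Morse image \<open>tm (A @ [True])\<close>, the marker \<open>01010\<close>, and
  \<open>tm [False]\<close>. The marker has odd length, so it shifts the parity of the decomposition into the pairs
  \<open>01\<close> and \<open>10\<close>, and five alternating letters do not occur inside the \<open>tm\<close>-image of a cube-free word.
  From the second letter of a marker to the last but one letter of the next marker stands exactly a
  \<open>tm\<close>-image, up to complementation that of \<open>110 A 100\<close> or of \<open>001 A 100\<close>. If these two words are
  cube-free, the markers occur only where they were put, at one residue modulo the length of the
  block; this yields both synchronization and the absence of short cubes.
\<close>

context
  fixes A :: "bool list"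
  assumes cube_free_110: "cube_free ([True, True, False] @ A @ [True, False, False])"
    and cube_free_001: "cube_free ([False, False, True] @ A @ [True, False, False])"
begin

definition block :: "bool list" where
  "block = tm A @ [True, False] @ [False, True, False, True, False] @ [False, True]"

text \<open>
  The preimage under \<open>tm\<close> of what lies between the marker in the image of the letter \<open>b\<close> and the marker
  in the image of the following letter \<open>c\<close>, including four letters of either marker.
\<close>

definition gap_preimage :: "bool \<Rightarrow> bool \<Rightarrow> bool list" where
  "gap_preimage b c = map ((\<noteq>) b) [True, True, False] @ map ((\<noteq>) c) (A @ [True, False, False])"

lemma length_block: "length block = 2 * length A + 9"
  by (simp add: block_def)

lemma cube_free_gap_preimage: "cube_free (gap_preimage b c)"
proof -
  have N: "map ((\<noteq>) True) x = map Not x" "map ((\<noteq>) False) x = x" for x :: "bool list"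
    by (simp_all add: map_idI)
  have "gap_preimage True c = map Not (gap_preimage False (\<not> c))" for c
    unfolding gap_preimage_def by (cases c) (simp_all only: N, simp_all add: o_def)
  moreover have "cube_free (gap_preimage False c)" for c
  proof (cases c)
    case True
    have "gap_preimage False c = map Not ([False, False, True] @ A @ [True, False, False])"
      unfolding gap_preimage_def using True by (simp only: N) simp
    then show ?thesis using cube_free_001 cube_free_map_Not by metis
  next
    case False
    then show ?thesis using cube_free_110 unfolding gap_preimage_def by (simp only: N)
  qed
  ultimately show ?thesis by (cases b) (auto simp: cube_free_map_Not)
qed

lemma cmorph_block_gap:
  "cmorph block [b, c] =
     map ((\<noteq>) b) (tm A @ [True, False, False]) @ tm (gap_preimage b c) @ map ((\<noteq>) c) [False, False, True]"
  by (cases b; cases c)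
     (simp_all add: cmorph_Cons block_def gap_preimage_def tm_Cons map_idI flip: tm_map_Not)

lemma run_in_gap:
  assumes r: "run (cmorph block w) p (length block * j + (2 * length A + 3) + s) n"
    and "j + 1 < length w" "s + n \<le> 2 * length A + 12"
  obtains b c where "run (tm (gap_preimage b c)) p s n"
proof -
  define b where "b = w ! j"
  define c where "c = w ! (j + 1)"
  have "w = take j w @ w ! j # w ! (j + 1) # drop (j + 2) w"
    using assms(2) by (simp add: Cons_nth_drop_Suc)
  then have "w = take j w @ [b, c] @ drop (j + 2) w"
    unfolding b_def c_def by simp
  then have "cmorph block w = cmorph block (take j w) @ cmorph block [b, c] @ cmorph block (drop (j + 2) w)"
    by (metis cmorph_append)
  also have "\<dots> = (cmorph block (take j w) @ map ((\<noteq>) b) (tm A @ [True, False, False])) @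
      tm (gap_preimage b c) @ (map ((\<noteq>) c) [False, False, True] @ cmorph block (drop (j + 2) w))"
    unfolding cmorph_block_gap by simp
  finally have eq: "cmorph block w = (cmorph block (take j w) @ map ((\<noteq>) b) (tm A @ [True, False, False])) @
      tm (gap_preimage b c) @ (map ((\<noteq>) c) [False, False, True] @ cmorph block (drop (j + 2) w))" .
  have len: "length (cmorph block (take j w) @ map ((\<noteq>) b) (tm A @ [True, False, False]))
      = length block * j + (2 * length A + 3)"
    using assms(2) by simp
  have "run (tm (gap_preimage b c)) p s n"
    by (rule run_infix[OF r[unfolded eq, folded len]]) (use assms(3) in \<open>simp add: gap_preimage_def\<close>)
  then show ?thesis by (rule that)
qed

lemma locate_gap:
  fixes s :: nat
  assumes "length block \<le> s"
  obtains j r where "s = length block * j + (2 * length A + 3) + r" "r < length block"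
proof -
  define k where "k = length block"
  define e where "e = s - (2 * length A + 3)"
  have "k > 0" by (simp add: k_def length_block)
  have "s = e + (2 * length A + 3)" using assms by (simp add: e_def length_block)
  also have "e = k * (e div k) + e mod k" by simp
  finally have "s = k * (e div k) + (2 * length A + 3) + e mod k" by simp
  moreover have "e mod k < k" using \<open>k > 0\<close> by simp
  ultimately show ?thesis using that unfolding k_def by blast
qed

text \<open>
  An extra block on either side puts every position between two markers, so that the ends of a word
  need no separate treatment.
\<close>

lemma pad_run:
  assumes "run (cmorph u w) p i n"
  shows "run (cmorph u ([False] @ w @ [False])) p (length u + i) n"
proof -
  have "run (cmorph u [False] @ cmorph u w @ cmorph u [False]) p (length (cmorph u [False]) + i) n"
    using assms run_length[OF assms] by (subst run_append_iff) auto
  moreover have "length (cmorph u [False]) = length u" by simp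
  ultimately show ?thesis by (simp only: cmorph_append)
qed

text \<open>
  Being \<open>01010\<close> or \<open>10101\<close> is relaxed to being a run of period two and length five, which passes through
  \<open>run_tm_obtain\<close>: such a run between two markers would come from three equal letters.
\<close>

lemma marker_position:
  assumes r: "run (cmorph block w) 2 t 5"
  shows "t mod length block = 2 * length A + 2"
proof -
  let ?k = "length block" and ?w = "[False] @ w @ [False]"
  have r': "run (cmorph block ?w) 2 (?k + t) 5" by (rule pad_run[OF r])
  obtain j s where s: "?k + t = ?k * j + (2 * length A + 3) + s" "s < ?k"
    using locate_gap[of "?k + t"] by auto
  show ?thesis
  \<comment> \<open>The offset \<open>s\<close> counts from one letter past a marker, so its largest value is the next marker.\<close>
  proof (cases "s = 2 * length A + 8")
    case True
    then have "t + ?k = (2 * length A + 2) + ?k * (j + 1)" using s by (simp add: length_block)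
    then have "(t + ?k) mod ?k = (2 * length A + 2) mod ?k" by (metis mod_mult_self2)
    then show ?thesis by (simp add: length_block)
  next
    case False
    then have le: "s + 5 \<le> 2 * length A + 12" using s by (simp add: length_block)
    have "?k * j < ?k * (length w + 1)"
      using run_length[OF r] s by (simp add: length_block)
    then have "j < length w + 1" by (metis mult_less_cancel1)
    then obtain b c where "run (tm (gap_preimage b c)) 2 s 5"
      using run_in_gap[of ?w 2 j s 5] r' s le by auto
    then obtain p i m where "2 = 2 * p" "run (gap_preimage b c) p i m" "5 \<le> 2 * m"
      using run_tm_obtain[of "gap_preimage b c" 2 s 5] by auto
    then have g: "run (gap_preimage b c) 1 i m" "3 \<le> m" by auto
    have "run (gap_preimage b c) 1 i (3 * 1)" by (rule run_subrun[OF g(1)]) (use g(2) in auto)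
    then show ?thesis using cube_free_gap_preimage[of b c] unfolding cube_free_def by (metis zero_less_one)
  qed
qed

lemma marker_run:
  assumes "j < length w"
  shows "run (cmorph block w) 2 (length block * j + (2 * length A + 2)) 5"
proof -
  define b where "b = w ! j"
  have "w = take j w @ [b] @ drop (j + 1) w"
    using assms by (simp add: b_def Cons_nth_drop_Suc)
  then have "cmorph block w = cmorph block (take j w) @ cmorph block [b] @ cmorph block (drop (j + 1) w)"
    by (metis cmorph_append)
  also have "\<dots> = (cmorph block (take j w) @ map ((\<noteq>) b) (tm A @ [True, False])) @
     map ((\<noteq>) b) [False, True, False, True, False] @ (map ((\<noteq>) b) [False, True] @ cmorph block (drop (j + 1) w))"
    by (simp add: cmorph_Cons block_def)
  finally have eq: "cmorph block w = (cmorph block (take j w) @ map ((\<noteq>) b) (tm A @ [True, False])) @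
     map ((\<noteq>) b) [False, True, False, True, False] @ (map ((\<noteq>) b) [False, True] @ cmorph block (drop (j + 1) w))" .
  have len: "length (cmorph block (take j w) @ map ((\<noteq>) b) (tm A @ [True, False])) + 0
     = length block * j + (2 * length A + 2)"
    using assms by simp
  have mr: "run (map ((\<noteq>) b) [False, True, False, True, False]) 2 0 5"
    by (auto simp: run_def less_Suc_eq numeral_eq_Suc)
  show ?thesis
    unfolding eq len[symmetric] by (rule run_append_iff[THEN iffD2, OF _ mr]) simp
qed

lemma synchronizing_block: "synchronizing block"
  unfolding synchronizing_def
proof (intro allI impI notI)
  fix a b c r
  let ?k = "length block" and ?d = "2 * length A + 2"
  assume r: "0 < r \<and> r < ?k" and eq: "take ?k (drop r (cmorph block [a, b])) = cmorph block [c]"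
  define X where "X = cmorph block [a, b]"
  have X: "take r X @ cmorph block [c] @ drop ?k (drop r X) = X"
    unfolding eq[symmetric] X_def by (simp only: append_take_drop_id)
  have len: "length (take r X) = r" using r by (simp add: X_def)
  have "run (cmorph block [c]) 2 ?d 5"
    using marker_run[of 0 "[c]"] by simp
  then have "run (take r X @ cmorph block [c] @ drop ?k (drop r X)) 2 (length (take r X) + ?d) 5"
    by (subst run_append_iff) (simp_all add: length_block)
  then have "run (cmorph block [a, b]) 2 (r + ?d) 5"
    unfolding X len by (simp only: X_def)
  then have "(r + ?d) mod ?k = ?d" by (rule marker_position)
  then have "(r + ?d) mod ?k = ?d mod ?k" by (simp add: length_block)
  then have "?k dvd r" by (metis add_diff_cancel_right' mod_eq_dvd_iff_nat le_add2)
  then show False using r by (simp add: nat_dvd_not_less)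
qed

text \<open>
  A short cube either avoids all markers, and then lies in the \<open>tm\<close>-image of a cube-free word, or
  contains a marker. In the latter case the marker also occurs one period further to the right or to
  the left, unless the period is at most three, and two markers are never less than a block apart.
  A cube of period one is too short to contain a marker. For the periods two and three, the period of
  the cube and that of the marker together give a second marker one or two letters away.
\<close>

lemma block_no_short_cube:
  assumes "0 < q" "q < length block"
  shows "\<not> run (cmorph block w) q i (3 * q)"
proof
  assume "run (cmorph block w) q i (3 * q)"
  let ?k = "length block" and ?d = "2 * length A + 2" and ?w = "[False] @ w @ [False]"
  define H where "H = cmorph block ?w"
  define s where "s = ?k + i"
  have cube: "run H q s (3 * q)" unfolding H_def s_def by (rule pad_run) fact
  have mark: "t mod ?k = ?d" if "run H 2 t 5" for t
    using marker_position that unfolding H_def by blast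
  have bnd: "s + 3 * q \<le> ?k * (length w + 1)"
    using run_length[OF \<open>run (cmorph block w) q i (3 * q)\<close>] by (simp add: s_def)
  obtain j r where r: "s = ?k * j + (?d + 1) + r" "r < ?k"
  proof -
    have "?k \<le> s" by (simp add: s_def)
    then show ?thesis using locate_gap that by (metis add.assoc numeral_3_eq_3 numeral_2_eq_2 add_Suc_right Suc_eq_plus1)
  qed
  have "?k * j < ?k * (length w + 1)" using bnd r by simp
  then have j: "j < length w + 1" by (metis mult_less_cancel1)
  show False
  proof (cases "r + 3 * q \<le> 2 * length A + 12")
    case True
    have eq: "s = ?k * j + (2 * length A + 3) + r" using r by simp
    have "j + 1 < length ?w" using j by simp
    then obtain b c where "run (tm (gap_preimage b c)) q r (3 * q)"
      using run_in_gap[OF cube[unfolded H_def eq] _ True] by blast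
    then show False
      using tm_cube_free[OF cube_free_gap_preimage] \<open>0 < q\<close> unfolding cube_free_def by blast
  next
    case False
    \<comment> \<open>The cube is too long for its gap, so it contains the marker at \<open>e\<close> that ends this gap.\<close>
    define e where "e = ?k * (j + 1) + ?d"
    have e: "s \<le> e" "e + 5 \<le> s + 3 * q"
      using r False by (auto simp: e_def length_block)
    have me: "run H 2 e 5" unfolding H_def e_def by (rule marker_run) (use j in simp)
    have no_shift: "\<not> run H 2 (e + l) 5" if "0 < l" "l < ?k" for l
    proof
      assume "run H 2 (e + l) 5"
      then have "(e + l) mod ?k = e mod ?k" using mark me by metis
      then have "?k dvd l" by (metis add_diff_cancel_left' mod_eq_dvd_iff_nat le_add1)
      then show False using that by (simp add: nat_dvd_not_less)
    qed
    have no_shift': "\<not> run H 2 e' 5" if "e' < e" "e < e' + ?k" for e'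
    proof
      assume "run H 2 e' 5"
      then have "(e' + (e - e')) mod ?k = e' mod ?k" using mark me that by (metis le_add_diff_inverse less_imp_le)
      then have "?k dvd e - e'" by (metis add_diff_cancel_left' mod_eq_dvd_iff_nat le_add1)
      then show False using that by (simp add: nat_dvd_not_less)
    qed
    have per: "H ! x = H ! (x + q)" if "s \<le> x" "x + q < s + 3 * q" for x
      using runD[OF cube] that by simp
    have Hlen: "s + 3 * q \<le> length H" using run_length[OF cube] .
    have m: "H ! e = H ! (e + 2)" "H ! (e + 1) = H ! (e + 3)" "H ! (e + 2) = H ! (e + 4)"
      using runD[OF me, of e] runD[OF me, of "e + 1"] runD[OF me, of "e + 2"] by (simp_all add: numeral_eq_Suc)
    have run5: "run H 2 x 5"
      if "s \<le> x" "x + 5 \<le> s + 3 * q" "H ! x = H ! (x + 2)" "H ! (x + 1) = H ! (x + 3)" "H ! (x + 2) = H ! (x + 4)" for x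
      unfolding run_def
    proof (intro conjI allI impI)
      show "x + 5 \<le> length H" using that Hlen by simp
      fix y assume "x \<le> y \<and> y + 2 < x + 5"
      then consider "y = x" | "y = x + 1" | "y = x + 2" by linarith
      then show "H ! y = H ! (y + 2)" using that by cases (simp_all add: numeral_eq_Suc)
    qed
    consider "e + q + 5 \<le> s + 3 * q" | "s + q \<le> e" | "s + 2 * q < e + 5" "e < s + q" by linarith
    then show False
    proof cases
      case 1
      have "H ! (e + l) = H ! (e + q + l)" if "l < 5" for l
        using per[of "e + l"] that 1 e by (simp add: algebra_simps)
      from this[of 0] this[of 1] this[of 2] this[of 3] this[of 4]
      have "run H 2 (e + q) 5" using m 1 e by (intro run5) auto
      then show False using no_shift assms by blast
    next
      case 2
      define e' where "e' = e - q"
      have e': "e = e' + q" "s \<le> e'" using 2 by (auto simp: e'_def)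
      have "H ! (e' + l) = H ! (e + l)" if "l < 5" for l
        using per[of "e' + l"] that e' e by (simp add: algebra_simps)
      from this[of 0] this[of 1] this[of 2] this[of 3] this[of 4]
      have "run H 2 e' 5" using m e e' by (intro run5) auto
      then show False using no_shift'[of e'] assms e' by auto
    next
      case 3
      then have "q = 2 \<and> (e = s \<or> e = s + 1) \<or> q = 3 \<and> e = s + 2"
        using e by linarith
      then show False
      proof (elim disjE conjE)
        assume q: "q = 2" and "e = s"
        have "run H 2 (e + 1) 5"
          using per[of s] per[of "s + 1"] per[of "s + 2"] per[of "s + 3"] q \<open>e = s\<close>
          by (intro run5) (auto simp: numeral_eq_Suc)
        then show False using no_shift[of 1] by (simp add: length_block)
      next
        assume q: "q = 2" and "e = s + 1"
        have "run H 2 s 5"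
          using per[of s] per[of "s + 1"] per[of "s + 2"] per[of "s + 3"] q
          by (intro run5) (auto simp: numeral_eq_Suc)
        then show False using no_shift'[of s] \<open>e = s + 1\<close> by (simp add: length_block)
      next
        assume q: "q = 3" and "e = s + 2"
        have "run H 2 s 5"
          using per[of s] per[of "s + 1"] per[of "s + 2"] per[of "s + 3"] q m \<open>e = s + 2\<close>
          by (intro run5) (auto simp: numeral_eq_Suc)
        then show False using no_shift'[of s] \<open>e = s + 2\<close> by (simp add: length_block)
      qed
    qed
  qed
qed

end

section \<open>Thue--Morse words between two markers\<close>

lemma suffix_nth:
  "suffix xs ys \<longleftrightarrow> length xs \<le> length ys \<and> (\<forall>j < length xs. ys ! (length ys - length xs + j) = xs ! j)"
proof
  assume "suffix xs ys"
  then show "length xs \<le> length ys \<and> (\<forall>j < length xs. ys ! (length ys - length xs + j) = xs ! j)"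
    by (auto simp: suffix_def nth_append)
next
  assume *: "length xs \<le> length ys \<and> (\<forall>j < length xs. ys ! (length ys - length xs + j) = xs ! j)"
  then have "drop (length ys - length xs) ys = xs"
    by (intro nth_equalityI) auto
  then show "suffix xs ys" by (metis suffix_drop)
qed

text \<open>
  Three letters appended to an overlap-free word can complete a cube only if its period is at most
  three, for otherwise more than two periods lie in the overlap-free part. The three forbidden endings
  are those that \<open>100\<close> would complete to a cube of period one, two and three.
\<close>

lemma cube_free_append_100:
  assumes of: "overlap_free S"
    and n1: "\<not> suffix [True, True] S" and n2: "\<not> suffix [True, False, True, False] S"
    and n3: "\<not> suffix [True, False, False, True, False, False] S"
  shows "cube_free (S @ [True, False, False])"
  unfolding cube_free_def
proof (intro allI impI notI)
  fix p i :: nat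
  let ?X = "S @ [True, False, False]" and ?N = "length S"
  assume "0 < p" and r: "run ?X p i (3 * p)"
  have len: "i + 3 * p \<le> ?N + 3" using run_length[OF r] by simp
  have "\<not> i + (2 * p + 1) \<le> ?N"
  proof
    assume le: "i + (2 * p + 1) \<le> ?N"
    have "run ?X p i (2 * p + 1)" by (rule run_subrun[OF r]) (use \<open>0 < p\<close> in auto)
    then have "run S p i (2 * p + 1)" using run_append_iff[of i "2 * p + 1" S "[]" _ p] le by auto
    then show False using of \<open>0 < p\<close> by (simp add: overlap_free_def)
  qed
  then have "?N \<le> i + 2 * p" by simp
  have X: "?X ! ?N = True" "?X ! (?N + 1) = False" "?X ! (?N + 2) = False"
    by (simp_all add: nth_append)
  have S: "?X ! j = S ! j" if "j < ?N" for j using that by (simp add: nth_append)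
  have per: "?X ! j = ?X ! (j + p)" if "i \<le> j" "j + p < i + 3 * p" for j
    using runD[OF r] that by blast
  consider "p = 1 \<and> i + 2 = ?N" | "p = 1 \<and> ?N \<le> i + 1" | "p = 2 \<and> i + 4 = ?N" | "p = 2 \<and> i + 3 = ?N"
    | "p = 3 \<and> i + 6 = ?N"
  proof -
    have "p = 1 \<or> p = 2 \<or> p = 3" using \<open>0 < p\<close> len \<open>?N \<le> i + 2 * p\<close> by linarith
    then show ?thesis using that len \<open>?N \<le> i + 2 * p\<close> by (elim disjE) (simp_all, linarith+)
  qed
  then show False
  proof cases
    case 1
    then have N: "?N = i + 2" "p = 1" by simp_all
    have "S ! i" "S ! (i + 1)"
      using per[of i] per[of "i + 1"] X(1) S[of i] S[of "i + 1"] N by (simp_all add: numeral_2_eq_2)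
    then show False using n1 N by (auto simp: suffix_nth less_Suc_eq numeral_eq_Suc)
  next
    case 2
    then show False using per[of ?N] X len by auto
  next
    case 3
    then have N: "?N = i + 4" "p = 2" by simp_all
    have "S ! i" "\<not> S ! (i + 1)" "S ! (i + 2)" "\<not> S ! (i + 3)"
      using per[of i] per[of "i + 1"] per[of "i + 2"] per[of "i + 3"] X(1,2) 
        S[of i] S[of "i + 1"] S[of "i + 2"] S[of "i + 3"] N by (simp_all add: numeral_eq_Suc)
    then show False using n2 N by (auto simp: suffix_nth less_Suc_eq numeral_eq_Suc)
  next
    case 4
    then show False using per[of ?N] X by simp
  next
    case 5
    then have N: "?N = i + 6" "p = 3" by simp_all
    have "S ! i" "\<not> S ! (i + 1)" "\<not> S ! (i + 2)" "S ! (i + 3)" "\<not> S ! (i + 4)" "\<not> S ! (i + 5)"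
      using per[of i] per[of "i + 1"] per[of "i + 2"] per[of "i + 3"] per[of "i + 4"] per[of "i + 5"] X
        S[of i] S[of "i + 1"] S[of "i + 2"] S[of "i + 3"] S[of "i + 4"] S[of "i + 5"] N
      by (simp_all add: numeral_eq_Suc)
    then show False using n3 N by (auto simp: suffix_nth less_Suc_eq numeral_eq_Suc)
  qed
qed

text \<open>
  In an image under \<open>tm\<close> two equal adjacent letters start at an odd position, but the two occurrences
  of \<open>00\<close> in \<open>100100\<close> start at distance three.
\<close>

lemma no_100100_in_tm:
  assumes "sublist S (tm v)" shows "\<not> suffix [True, False, False, True, False, False] S"
proof
  assume "suffix [True, False, False, True, False, False] S"
  then have "sublist [True, False, False, True, False, False] (tm v)"
    using assms by (meson suffix_imp_sublist sublist_order.order_trans)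
  then obtain xs ys where eq: "tm v = xs @ [True, False, False, True, False, False] @ ys"
    by (auto simp: sublist_def)
  let ?l = "length xs"
  have len: "2 * length v = ?l + 6 + length ys" using arg_cong[OF eq, of length] by simp
  have n: "\<not> tm v ! (?l + 1)" "\<not> tm v ! (?l + 2)" "\<not> tm v ! (?l + 4)" "\<not> tm v ! (?l + 5)"
    by (simp_all add: eq nth_append)
  have "odd (?l + 1)" using nth_tm_Suc[of "?l + 1" v] n len by auto
  moreover have "odd (?l + 4)" using nth_tm_Suc[of "?l + 4" v] n len by (auto simp: numeral_eq_Suc)
  ultimately show False by simp
qed

text \<open>
  The square of \<open>tm\<close> is iterated because it maps \<open>b\<close> to a word that begins and ends with \<open>b\<close>.
\<close>

definition tmw :: "nat \<Rightarrow> bool \<Rightarrow> bool list" where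
  "tmw m b = ((\<lambda>w. tm (tm w)) ^^ m) [b]"

lemma tmw_0: "tmw 0 b = [b]" and tmw_Suc: "tmw (Suc m) b = tm (tm (tmw m b))"
  by (simp_all add: tmw_def)

lemma length_tmw: "length (tmw m b) = 4 ^ m"
  by (induction m) (auto simp: tmw_0 tmw_Suc)

lemma tmw_Not: "tmw m (\<not> b) = map Not (tmw m b)"
  by (induction m) (auto simp: tmw_0 tmw_Suc tm_map_Not)

lemma tmw_ends: "\<exists>xs. tmw m b = xs @ [b]"
  by (induction m) (auto simp: tmw_0 tmw_Suc tm_Cons)

lemma tmw_begins: "\<exists>xs. tmw m b = b # xs"
  by (induction m) (auto simp: tmw_0 tmw_Suc tm_Cons)

lemma overlap_free_tmw: "overlap_free (tmw m c @ tmw m b)"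
proof (induction m)
  case 0
  have "\<not> run [c, b] p i (2 * p + 1)" if "0 < p" for p i
    using that run_length[of "[c, b]" p i "2 * p + 1"] by auto
  then show ?case by (simp add: tmw_0 overlap_free_def)
next
  case (Suc m)
  from tm_overlap_free[OF tm_overlap_free[OF Suc]] show ?case by (simp add: tmw_Suc)
qed

text \<open>
  The word \<open>A\<close> is a prefix of a Thue--Morse word \<open>tmw m b\<close>. For \<open>m > 0\<close> the word \<open>tmw m False\<close> ends in
  \<open>110\<close> and \<open>tmw m True\<close> ends in \<open>001\<close>, so both words \<open>110 A\<close> and \<open>001 A\<close> are factors of overlap-free
  words. The endings \<open>11\<close> and \<open>1010\<close>, after which \<open>100\<close> would complete a cube, are avoided by the choice
  of \<open>b\<close>: exchanging the two letters of \<open>A\<close> turns them into \<open>00\<close> and \<open>0101\<close>. Prefixes shorter than the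
  longer ending are checked one by one.
\<close>

lemma extendable_word_exists:
  "\<exists>A. length A = n \<and> cube_free ([True, True, False] @ A @ [True, False, False]) \<and>
    cube_free ([False, False, True] @ A @ [True, False, False])"
proof -
  define pre where "pre c = [\<not> c, \<not> c, c]" for c :: bool
  define A where "A b = take n (tmw (Suc n) b)" for b
  have "n < 4 ^ n" by (induction n) auto
  then have n: "n \<le> 4 ^ Suc n" by simp
  have lenA: "length (A b) = n" for b using n by (simp add: A_def length_tmw)
  have A_Not: "A True = map Not (A False)" unfolding A_def using tmw_Not[of "Suc n" False] by (simp add: take_map)
  have sub: "sublist (pre c @ A b) (tmw (Suc n) c @ tmw (Suc n) b)" for b c
  proof -
    obtain xs where "tmw n c = xs @ [c]" using tmw_ends by blast
    then have "tmw (Suc n) c = (tm (tm xs) @ [c]) @ pre c" by (simp add: tmw_Suc tm_Cons pre_def)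
    moreover have "tmw (Suc n) b = A b @ drop n (tmw (Suc n) b)" by (simp add: A_def)
    ultimately show ?thesis unfolding sublist_def by (metis append.assoc)
  qed
  have ok: "cube_free (pre c @ A b @ [True, False, False])"
    if "\<not> suffix [True, True] (pre c @ A b)" "\<not> suffix [True, False, True, False] (pre c @ A b)" for b c
  proof -
    have "overlap_free (pre c @ A b)" using overlap_free_sublist[OF overlap_free_tmw sub] .
    moreover have "tmw (Suc n) c @ tmw (Suc n) b = tm (tm (tmw n c) @ tm (tmw n b))" by (simp add: tmw_Suc)
    then have "\<not> suffix [True, False, False, True, False, False] (pre c @ A b)"
      using no_100100_in_tm sub by metis
    ultimately show ?thesis using cube_free_append_100[of "pre c @ A b"] that by simp
  qed
  have "\<exists>b. \<forall>c. \<not> suffix [True, True] (pre c @ A b) \<and> \<not> suffix [True, False, True, False] (pre c @ A b)"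
  proof (cases "n < 4")
    case True
    have "A b = take n [b, \<not> b, \<not> b, b]" for b
    proof -
      obtain xs where "tmw n b = b # xs" using tmw_begins by blast
      then have "tmw (Suc n) b = [b, \<not> b, \<not> b, b] @ tm (tm xs)" by (simp add: tmw_Suc tm_Cons)
      then show ?thesis using True by (simp only: A_def take_append) simp
    qed
    moreover have "n = 0 \<or> n = 1 \<or> n = 2 \<or> n = 3" using True by auto
    ultimately have "A False = [] \<or> A False = [False] \<or> A False = [False, True] \<or> A True = [True, False, False]"
      by (auto simp: numeral_eq_Suc)
    then have "(\<forall>c. \<not> suffix [True, True] (pre c @ A False) \<and> \<not> suffix [True, False, True, False] (pre c @ A False))
       \<or> (\<forall>c. \<not> suffix [True, True] (pre c @ A True) \<and> \<not> suffix [True, False, True, False] (pre c @ A True))"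
      by (elim disjE) (simp_all add: pre_def suffix_nth less_Suc_eq all_conj_distrib numeral_eq_Suc)
    then show ?thesis by blast
  next
    case False
    have suf: "suffix xs (pre c @ A b) \<longleftrightarrow> suffix xs (A b)" if "length xs \<le> 4" for xs b c
    proof -
      have "length xs \<le> length (A b)" using that False lenA by simp
      then show ?thesis by (metis suffix_appendI suffix_append suffix_def suffix_length_suffix suffix_order.order_refl)
    qed
    have sN: "suffix (map Not xs) (A False)" if "suffix xs (A True)" for xs
      using that unfolding A_Not by (auto simp: suffix_nth)
    show ?thesis
    proof (cases "suffix [True, True] (A False) \<or> suffix [True, False, True, False] (A False)")
      case True
      have clash: "\<not> suffix y (A False)"
        if "suffix x (A False)" "\<not> suffix x y" "\<not> suffix y x" for x y
        using suffix_same_cases that by blast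
      have "\<not> suffix [False, False] (A False)"
        using True by (elim disjE) (erule clash; simp add: suffix_to_prefix)+
      then have "\<not> suffix [True, True] (A True)"
        using sN[of "[True, True]"] by auto
      moreover have "\<not> suffix [False, True, False, True] (A False)"
        using True by (elim disjE) (erule clash; simp add: suffix_to_prefix)+
      then have "\<not> suffix [True, False, True, False] (A True)"
        using sN[of "[True, False, True, False]"] by auto
      ultimately show ?thesis using suf by (intro exI[of _ True]) simp
    next
      case False
      then show ?thesis using suf by (intro exI[of _ False]) simp
    qed
  qed
  then obtain b where "\<And>c. cube_free (pre c @ A b @ [True, False, False])" using ok by blast
  from this[of False] this[of True] show ?thesis using lenA by (auto simp: pre_def)
qed

section \<open>Deciding the existence of runs\<close>

text \<open>
  A run of length \<open>m + p\<close> with period \<open>p\<close> is a stretch of \<open>m\<close> positions on which the word agrees with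
  itself shifted by \<open>p\<close>. The following functions find such a stretch by structural recursion, which
  lets the simplifier decide concrete instances.
\<close>

fun agree :: "nat \<Rightarrow> bool list \<Rightarrow> bool list \<Rightarrow> bool" where
  "agree 0 xs ys = True"
| "agree (Suc m) (x # xs) (y # ys) = (x = y \<and> agree m xs ys)"
| "agree (Suc m) _ _ = False"

fun ex_agree :: "nat \<Rightarrow> bool list \<Rightarrow> bool list \<Rightarrow> bool" where
  "ex_agree m (x # xs) (y # ys) = (agree m (x # xs) (y # ys) \<or> ex_agree m xs ys)"
| "ex_agree m xs ys = agree m xs ys"

definition has_run :: "bool list \<Rightarrow> nat \<Rightarrow> nat \<Rightarrow> bool" where
  "has_run w p m = ex_agree m w (drop p w)"

lemma agree_iff:
  "agree m xs ys \<longleftrightarrow> m \<le> length xs \<and> m \<le> length ys \<and> (\<forall>j < m. xs ! j = ys ! j)"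
  by (induction m xs ys rule: agree.induct) (auto simp: All_less_Suc2)

lemma ex_agree_iff:
  "ex_agree m xs ys \<longleftrightarrow> (\<exists>i. i \<le> length xs \<and> i \<le> length ys \<and> agree m (drop i xs) (drop i ys))"
proof (induction m xs ys rule: ex_agree.induct)
  case (1 m x xs y ys)
  show ?case (is "_ \<longleftrightarrow> (\<exists>i. ?P i)")
  proof -
    have "(\<exists>i. ?P i) \<longleftrightarrow> ?P 0 \<or> (\<exists>i. ?P (Suc i))" by (metis not0_implies_Suc)
    then show ?thesis using 1 by simp
  qed
qed auto

lemma run_iff_agree:
  "run w p i (m + p) \<longleftrightarrow> i + m + p \<le> length w \<and> agree m (drop i w) (drop (i + p) w)"
proof
  assume r: "run w p i (m + p)"
  have "w ! (i + j) = w ! (i + j + p)" if "j < m" for j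
    by (rule runD[OF r]) (use that in auto)
  then show "i + m + p \<le> length w \<and> agree m (drop i w) (drop (i + p) w)"
    using run_length[OF r] by (auto simp: agree_iff add_ac)
next
  assume *: "i + m + p \<le> length w \<and> agree m (drop i w) (drop (i + p) w)"
  show "run w p i (m + p)"
    unfolding run_def
  proof (intro conjI allI impI)
    show "i + (m + p) \<le> length w" using * by simp
    fix j assume j: "i \<le> j \<and> j + p < i + (m + p)"
    then obtain l where l: "j = i + l" using le_Suc_ex by blast
    then have "drop i w ! l = drop (i + p) w ! l" using * j by (auto simp: agree_iff)
    then show "w ! j = w ! (j + p)" using * l by (simp add: add_ac)
  qed
qed

lemma has_run_iff_run:
  assumes "p \<le> length w"
  shows "has_run w p m \<longleftrightarrow> (\<exists>i. run w p i (m + p))"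
  unfolding has_run_def ex_agree_iff run_iff_agree
proof (intro ex_cong1)
  fix i
  have "m \<le> length w - (i + p)" if "agree m (drop i w) (drop (i + p) w)"
    using that by (simp add: agree_iff)
  then show "(i \<le> length w \<and> i \<le> length (drop p w) \<and> agree m (drop i w) (drop i (drop p w))) \<longleftrightarrow>
      (i + m + p \<le> length w \<and> agree m (drop i w) (drop (i + p) w))"
    using assms by auto
qed

section \<open>The lengths five, seven and twelve\<close>

text \<open>
  Four letters suffice, because a cube whose period is less than the block length has length at most
  \<open>3 * length u - 3\<close> and hence meets at most four blocks.
\<close>

definition no_short_cube :: "bool list \<Rightarrow> bool" where
  "no_short_cube u \<longleftrightarrow> (\<forall>v\<in>set (List.n_lists 4 [False, True]). \<forall>q\<in>set [1..<length u].
     \<not> has_run (cmorph u v) q (2 * q))"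

lemma n_lists_bool: "v \<in> set (List.n_lists n [False, True]) \<longleftrightarrow> length v = n"
  by (auto simp: set_n_lists)

lemma no_short_cubeD:
  assumes "no_short_cube u" "0 < q" "q < length u"
  shows "\<not> run (cmorph u w) q i (3 * q)"
proof
  assume r: "run (cmorph u w) q i (3 * q)"
  let ?k = "length u"
  \<comment> \<open>Padding makes four full blocks available from every position on.\<close>
  define w' where "w' = w @ replicate 4 False"
  define j where "j = i div ?k"
  have i: "i = ?k * j + i mod ?k" by (simp add: j_def)
  have im: "i mod ?k < ?k" using assms by (intro mod_less_divisor) linarith
  have bnd: "i + 3 * q \<le> ?k * length w" using run_length[OF r] by simp
  then have "?k * j < ?k * length w" using assms(2) i by linarith
  then have j: "j < length w" by (metis mult_less_cancel1)
  define v where "v = take 4 (drop j w')"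
  have v: "length v = 4" using j by (simp add: v_def w'_def)
  have w': "w' = take j w' @ v @ drop 4 (drop j w')" unfolding v_def by (simp only: append_take_drop_id)
  have "run (cmorph u [] @ cmorph u w @ cmorph u (replicate 4 False)) q (length (cmorph u []) + i) (3 * q)"
    by (rule run_append_iff[THEN iffD2, OF _ r]) (use bnd in simp)
  then have "run (cmorph u w') q i (3 * q)" by (simp add: w'_def)
  moreover have "cmorph u w' = cmorph u (take j w') @ cmorph u v @ cmorph u (drop 4 (drop j w'))"
    using w' by (metis cmorph_append)
  moreover have "i = length (cmorph u (take j w')) + i mod ?k" using j i by (simp add: w'_def)
  ultimately have "run (cmorph u (take j w') @ cmorph u v @ cmorph u (drop 4 (drop j w'))) q
     (length (cmorph u (take j w')) + i mod ?k) (3 * q)" by simp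
  then have "run (cmorph u v) q (i mod ?k) (3 * q)"
    by (rule run_infix) (use im assms v in simp)
  then have "run (cmorph u v) q (i mod ?k) (2 * q + q)" by (simp add: algebra_simps)
  moreover have "q \<le> length (cmorph u v)" using assms v by simp
  ultimately have "has_run (cmorph u v) q (2 * q)" using has_run_iff_run by blast
  moreover have "v \<in> set (List.n_lists 4 [False, True])" "q \<in> set [1..<?k]"
    using v assms by (simp_all add: n_lists_bool)
  ultimately show False using assms(1) unfolding no_short_cube_def by blast
qed

definition sync_check :: "bool list \<Rightarrow> bool" where
  "sync_check u \<longleftrightarrow> (\<forall>v\<in>set (List.n_lists 2 [False, True]). \<forall>c\<in>set [False, True]. \<forall>r\<in>set [1..<length u].
      take (length u) (drop r (cmorph u v)) \<noteq> cmorph u [c])"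

lemma sync_checkD: "sync_check u \<Longrightarrow> synchronizing u"
  unfolding synchronizing_def
proof (intro allI impI)
  fix a b c r assume "sync_check u" "0 < r \<and> r < length u"
  moreover have "[a, b] \<in> set (List.n_lists 2 [False, True])" "c \<in> set [False, True]"
    by (simp add: n_lists_bool, cases c, simp_all)
  ultimately show "take (length u) (drop r (cmorph u [a, b])) \<noteq> cmorph u [c]"
    unfolding sync_check_def by (metis atLeastLessThan_iff set_upt Suc_leI One_nat_def)
qed

text \<open>
  These blocks are witnesses found by exhaustive search. The lengths five and seven are too short for the
  marker construction, and twelve is twice the impossible length six.
\<close>

lemma check_5: "sync_check [False, True, False, False, True] \<and> no_short_cube [False, True, False, False, True]"
  by code_simp

lemma check_7: "sync_check [False, True, False, False, True, True, False] \<and>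
   no_short_cube [False, True, False, False, True, True, False]"
  by code_simp

lemma check_12: "sync_check [False, True, False, False, True, False, True, False, False, True, True, False] \<and>
   no_short_cube [False, True, False, False, True, False, True, False, False, True, True, False]"
  by code_simp

section \<open>All lengths other than three and six\<close>

text \<open>
  Freeness on a whole interval of exponents below \<open>3\<close>, rather than at one exponent, makes the notion
  stable under composition.
\<close>

definition good_length :: "nat \<Rightarrow> bool" where
  "good_length k \<longleftrightarrow> (\<exists>h a0. complementary_morphism h \<and> uniform_morphism k h \<and> a0 < 3 \<and>
     (\<forall>a. a0 \<le> a \<and> a < 3 \<longrightarrow> free_morphism (Exactly a) h))"

lemma good_length_block:
  assumes "synchronizing u" "u \<noteq> []"
    and "\<And>w q i. 0 < q \<Longrightarrow> q < length u \<Longrightarrow> \<not> run (cmorph u w) q i (3 * q)"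
  shows "good_length (length u)"
  unfolding good_length_def
proof (intro exI conjI allI impI)
  show "3 - 1 / real (length u) < 3" using assms(2) by simp
  show "free_morphism (Exactly a) (cmorph u)" if "3 - 1 / real (length u) \<le> a \<and> a < 3" for a
    using free_morphism_cmorph assms that by blast
qed (fact uniform_cmorph complementary_cmorph)+

lemma good_length_double:
  assumes "good_length k" shows "good_length (2 * k)"
proof -
  obtain h a0 where h: "complementary_morphism h" "uniform_morphism k h" "a0 < 3"
    and fr: "\<And>a. a0 \<le> a \<Longrightarrow> a < 3 \<Longrightarrow> free_morphism (Exactly a) h"
    using assms unfolding good_length_def by blast
  have bm: "binary_morphism (tm \<circ> h)" using h(2) by (auto simp: uniform_morphism_def binary_morphism_def)
  have um: "uniform_morphism (2 * k) (tm \<circ> h)" using h(2) bm by (auto simp: uniform_morphism_def)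
  have cm: "complementary_morphism (tm \<circ> h)"
    using h(1) um unfolding complementary_morphism_def complement_def by (auto simp: tm_map_Not)
  have "free_morphism (Exactly a) (tm \<circ> h)" if "max a0 (5/2) \<le> a \<and> a < 3" for a
  proof -
    have "free_morphism (Exactly a) h" "free_morphism (Exactly a) tm"
      using fr free_morphism_tm that by auto
    then show ?thesis using bm unfolding free_morphism_def by auto
  qed
  moreover have "max a0 (5/2) < 3" using h(3) by simp
  ultimately show ?thesis using cm um unfolding good_length_def by blast
qed

lemma good_length_odd:
  assumes "9 \<le> k" "odd k" shows "good_length k"
proof -
  have "even (k - 9)" using assms by simp
  then obtain n where "k - 9 = 2 * n" by blast
  then have k: "k = 2 * n + 9" using assms by simp
  obtain A where A: "length A = n" "cube_free ([True, True, False] @ A @ [True, False, False])"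
    "cube_free ([False, False, True] @ A @ [True, False, False])" using extendable_word_exists by blast
  have len: "length (block A) = k" using length_block[OF A(2,3)] A(1) k by simp
  then have "block A \<noteq> []" using k by auto
  from good_length_block[OF synchronizing_block[OF A(2,3)] this block_no_short_cube[OF A(2,3)]]
  show ?thesis by (simp add: len)
qed

lemma good_length_small: "good_length 1" "good_length 5" "good_length 7" "good_length 12"
proof -
  have "synchronizing [False]" by (simp add: synchronizing_def)
  then show "good_length 1" using good_length_block[of "[False]"] by simp
  have "good_length (length u)" if "sync_check u \<and> no_short_cube u" "u \<noteq> []" for u
    using good_length_block[of u] sync_checkD no_short_cubeD that by blast
  from this[OF check_5] this[OF check_7] this[OF check_12]
  show "good_length 5" "good_length 7" "good_length 12" by (simp_all add: numeral_eq_Suc)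
qed

lemma good_length_all:
  assumes "0 < k" "k \<noteq> 3" "k \<noteq> 6" shows "good_length k"
  using assms
proof (induction k rule: less_induct)
  case (less k)
  show ?case
  proof (cases "even k")
    case True
    then obtain l where l: "k = 2 * l" by blast
    show ?thesis
    proof (cases "l = 6")
      case True
      then show ?thesis using good_length_small l by simp
    next
      case False
      then have "good_length l" using less l by auto
      then show ?thesis using good_length_double l by simp
    qed
  next
    case False
    show ?thesis
    proof (cases "9 \<le> k")
      case True
      then show ?thesis using good_length_odd False by simp
    next
      case nine: False
      then have "k \<in> {1, 3, 5, 7}" using False by (simp; presburger)
      then show ?thesis using good_length_small less.prems by auto
    qed
  qed
qed

section \<open>Repetitions that fall just short of an exponent\<close>

text \<open>
  A critical word is a run of exponent \<open>L / p\<close> with one more letter on either side and with no larger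
  exponent. The two extra letters are what lets \<open>run_concat_uniform\<close> lengthen the image of the run on
  both sides.
\<close>

definition critical_word :: "bool list \<Rightarrow> nat \<Rightarrow> nat \<Rightarrow> bool" where
  "critical_word w L p \<longleftrightarrow> 0 < p \<and> p \<le> L \<and> length w = L + 2 \<and> run w p 1 L \<and>
     (\<forall>q i n. 0 < q \<and> q \<le> n \<and> run w q i n \<longrightarrow> n * p \<le> L * q)"

text \<open>
  The expression \<open>L * q div p + 1\<close> is the smallest length for which a run of period \<open>q\<close> has exponent
  larger than \<open>L / p\<close>.
\<close>

definition critical_check :: "bool list \<Rightarrow> nat \<Rightarrow> nat \<Rightarrow> bool" where
  "critical_check w L p \<longleftrightarrow> 0 < p \<and> p \<le> L \<and> length w = L + 2 \<and>
     agree (L - p) (drop 1 w) (drop (1 + p) w) \<and>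
     (\<forall>q\<in>set [1..<length w]. \<not> has_run w q (L * q div p + 1 - q))"

lemma critical_checkD:
  assumes "critical_check w L p" shows "critical_word w L p"
  unfolding critical_word_def
proof (intro conjI allI impI)
  show c: "0 < p" "p \<le> L" "length w = L + 2" using assms by (simp_all add: critical_check_def)
  show "run w p 1 L"
    using run_iff_agree[of w p 1 "L - p"] assms c by (auto simp: critical_check_def)
  fix q i n assume r: "0 < q \<and> q \<le> n \<and> run w q i n"
  show "n * p \<le> L * q"
  proof (rule ccontr)
    assume "\<not> n * p \<le> L * q"
    then have "L * q div p < n" using c by (simp add: less_mult_imp_div_less)
    have "q * p \<le> L * q" using c by simp
    then have "q \<le> L * q div p" using c by (simp add: less_eq_div_iff_mult_less_eq)
    have "q < length w"
      using run_length[of w q i n] r \<open>L * q div p < n\<close> \<open>q \<le> L * q div p\<close> by linarith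
    define m where "m = L * q div p + 1 - q"
    have "run w q i (m + q)"
      by (rule run_subrun[of w q i n])
         (use r \<open>L * q div p < n\<close> \<open>q \<le> L * q div p\<close> in \<open>auto simp: m_def\<close>)
    then have "has_run w q m" using has_run_iff_run \<open>q < length w\<close> by auto
    then show False using assms r \<open>q < length w\<close> unfolding critical_check_def m_def by auto
  qed
qed

text \<open>
  A seed is the fourth power of a word of length \<open>p\<close> all of whose conjugates have overlap-free squares:
  no period below \<open>p\<close> reaches beyond exponent two. The fixed beginning provides a place at which
  the periodicity can be broken without creating a cube of a single letter.
\<close>

definition seed :: "nat \<Rightarrow> bool list \<Rightarrow> bool" where
  "seed p s \<longleftrightarrow> 3 \<le> p \<and> run s p 0 (4 * p) \<and> length s = 4 * p \<and>
     take 5 s = [False, True, True, False, True] \<and>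
     (\<forall>q i. 0 < q \<and> q < p \<longrightarrow> \<not> run s q i (2 * q + 1))"

lemma seed_tm:
  assumes "seed p s" shows "seed (2 * p) (tm s)"
  unfolding seed_def
proof (intro conjI allI impI)
  show "3 \<le> 2 * p" "length (tm s) = 4 * (2 * p)" using assms by (auto simp: seed_def)
  have "run (tm s) (2 * p) (2 * 0 - 0) (2 * (4 * p) + 0 + 0)"
    unfolding tm_def cmorph_def
    by (rule run_concat_uniform) (use assms in \<open>auto simp: seed_def\<close>)
  then show "run (tm s) (2 * p) 0 (4 * (2 * p))" by (simp add: mult.left_commute)
  have "take 5 s = [False, True, True, False, True]" using assms by (simp add: seed_def)
  then have "s = [False, True, True, False, True] @ drop 5 s" by (metis append_take_drop_id)
  then have "tm s = tm [False, True, True, False, True] @ tm (drop 5 s)" by (metis tm_append)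
  then show "take 5 (tm s) = [False, True, True, False, True]" by (simp add: tm_Cons)
  fix q i assume "0 < q \<and> q < 2 * p"
  then show "\<not> run (tm s) q i (2 * q + 1)"
    using tm_no_overlap_run[of p s q i] assms by (auto simp: seed_def)
qed

lemma seed_check:
  assumes "3 \<le> p \<and> agree (3 * p) s (drop p s) \<and> length s = 4 * p \<and>
     take 5 s = [False, True, True, False, True] \<and> (\<forall>q\<in>set [1..<p]. \<not> has_run s q (q + 1))"
  shows "seed p s"
  unfolding seed_def
proof (intro conjI allI impI)
  have "run s p 0 (3 * p + p)" using assms by (simp only: run_iff_agree) simp
  then show "run s p 0 (4 * p)" by simp
  fix q i assume q: "0 < q \<and> q < p"
  show "\<not> run s q i (2 * q + 1)"
  proof
    assume "run s q i (2 * q + 1)"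
    then have "run s q i ((q + 1) + q)" by (simp add: mult_2)
    then have "has_run s q (q + 1)" using has_run_iff_run[of q s] q assms by auto
    then show False using assms q by auto
  qed
qed (use assms in auto)

lemma seed_3: "seed 3 (concat (replicate 4 [False, True, True]))"
  by (rule seed_check) code_simp

lemma seed_8: "seed 8 (tm (tm (concat (replicate 4 [False, True]))))"
  by (rule seed_check) code_simp

text \<open>
  The word is a stretch of the periodic word \<open>s\<close> of length \<open>3 * p + 1\<close> that starts and ends at the letter
  \<open>s ! 2\<close>, with this letter changed at both ends. The changes confine the run of period \<open>p\<close> to length
  \<open>3 * p - 1\<close>. Any shorter period \<open>q\<close> gains at most one letter beyond \<open>2 * q\<close>, since a run that uses
  both changed letters would be the whole word. This is harmless for \<open>q \<ge> 2\<close>, as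
  \<open>2 + 1 / q \<le> 5 / 2 \<le> 3 - 1 / p\<close>, and for \<open>q = 1\<close> it is excluded by the letters \<open>01\<close> on either side of
  \<open>s ! 2\<close>.
\<close>

lemma critical_word_seed:
  assumes "seed p s"
  shows "critical_word ([False] @ take (3 * p - 1) (drop 3 s) @ [False]) (3 * p - 1) p"
proof -
  let ?w = "[False] @ take (3 * p - 1) (drop 3 s) @ [False]"
  have p3: "3 \<le> p" and len: "length s = 4 * p" and per: "run s p 0 (4 * p)"
    and small: "\<And>q i. 0 < q \<Longrightarrow> q < p \<Longrightarrow> \<not> run s q i (2 * q + 1)"
    using assms by (auto simp: seed_def)
  have t5: "take 5 s = [False, True, True, False, True]" using assms by (simp add: seed_def)
  have s5: "s ! 0 = False" "s ! 1 = True" "s ! 2 = True" "s ! 3 = False" "s ! 4 = True"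
    using nth_take[of 0 5 s] nth_take[of 1 5 s] nth_take[of 2 5 s] nth_take[of 3 5 s] nth_take[of 4 5 s]
    unfolding t5 by (simp_all add: numeral_eq_Suc)
  have lenw: "length ?w = 3 * p + 1" using len p3 by simp
  have w: "?w ! j = s ! (j + 2)" if "1 \<le> j" "j < 3 * p" for j
    using that len p3 by (cases j) (auto simp: nth_append numeral_eq_Suc)
  have w0: "?w ! 0 = False" and wl: "?w ! (3 * p) = False"
    using len p3 by (auto simp: nth_append nth_Cons split: nat.splits)
  have sp: "s ! j = s ! (j + p)" if "j + p < 4 * p" for j
    using runD[OF per, of j] that by simp
  have sp3: "s ! (3 * p + j) = s ! j" if "j < p" for j
  proof -
    have "s ! j = s ! (j + p + p + p)"
      using sp[of j] sp[of "j + p"] sp[of "j + p + p"] that by simp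
    moreover have "j + p + p + p = 3 * p + j" by simp
    ultimately show ?thesis by metis
  qed
  have inner: "run s q (i + 2) n" if "run ?w q i n" "1 \<le> i" "i + n \<le> 3 * p" for q i n
    unfolding run_def
  proof (intro conjI allI impI)
    show "i + 2 + n \<le> length s" using that len p3 by simp
    fix j assume j: "i + 2 \<le> j \<and> j + q < i + 2 + n"
    then obtain l where l: "j = l + 2" by (metis add.commute le_Suc_ex add.assoc)
    have "?w ! l = ?w ! (l + q)" using runD[OF that(1), of l] j l by simp
    then show "s ! j = s ! (j + q)" using w[of l] w[of "l + q"] l j that by (simp add: add_ac)
  qed
  have no3: "n \<le> 2 * q" if "run ?w q i n" "1 \<le> i" "i + n \<le> 3 * p" "0 < q" "q < p" for q i n
  proof (rule ccontr)
    assume "\<not> n \<le> 2 * q"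
    then have "run s q (i + 2) (2 * q + 1)" by (intro run_subrun[OF inner[OF that(1-3)]]) auto
    then show False using small that by blast
  qed
  show ?thesis
    unfolding critical_word_def
  proof (intro conjI allI impI)
    show "0 < p" "p \<le> 3 * p - 1" "length ?w = 3 * p - 1 + 2" using p3 lenw by auto
    show "run ?w p 1 (3 * p - 1)"
      unfolding run_def
    proof (intro conjI allI impI)
      show "1 + (3 * p - 1) \<le> length ?w" using lenw by simp
      fix j assume j: "1 \<le> j \<and> j + p < 1 + (3 * p - 1)"
      then show "?w ! j = ?w ! (j + p)"
        using w[of j] w[of "j + p"] sp[of "j + 2"] p3 by (simp add: add_ac)
    qed
    fix q i n assume q: "0 < q \<and> q \<le> n \<and> run ?w q i n"
    then have r: "run ?w q i n" by simp
    have bnd: "i + n \<le> 3 * p + 1" using run_length[OF r] lenw by simp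
    consider "q = p" | "p < q" | "q < p" by linarith
    then show "n * p \<le> (3 * p - 1) * q"
    proof cases
      case 1
      have "n \<le> 3 * p - 1"
      proof (rule ccontr)
        assume "\<not> n \<le> 3 * p - 1"
        then have n: "3 * p \<le> n" by simp
        then consider "i = 0" | "i = 1" "n = 3 * p" using bnd by linarith
        then show False
        proof cases
          case 1
          then have "?w ! 0 = ?w ! p" using runD[OF r, of 0] n \<open>q = p\<close> p3 by simp
          moreover have "?w ! p = s ! (p + 2)" by (rule w) (use p3 in auto)
          moreover have "s ! (p + 2) = s ! 2" using sp[of 2] p3 by (simp add: add.commute)
          ultimately show False using w0 s5 by simp
        next
          case 2
          then have "?w ! (2 * p) = ?w ! (3 * p)" using runD[OF r, of "2 * p"] \<open>q = p\<close> p3 by simp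
          moreover have "?w ! (2 * p) = s ! (2 * p + 2)" by (rule w) (use p3 in auto)
          moreover have "s ! (2 * p + 2) = s ! 2"
            using sp[of 2] sp[of "p + 2"] p3 by (simp add: mult_2 add_ac)
          ultimately show False using wl s5 by simp
        qed
      qed
      then show ?thesis using 1 by simp
    next
      case 2
      have "n * p \<le> (3 * p + 1) * p" using bnd by (intro mult_le_mono1) simp
      also have "\<dots> \<le> (3 * p - 1) * (p + 1)"
      proof -
        obtain c where "p = c + 3" using p3 le_Suc_ex by (metis add.commute)
        then show ?thesis by (simp add: algebra_simps)
      qed
      also have "\<dots> \<le> (3 * p - 1) * q" using 2 by (intro mult_le_mono2) simp
      finally show ?thesis .
    next
      case 3
      have n2: "n \<le> 2 * q + 1"
      proof (rule ccontr)
        assume "\<not> n \<le> 2 * q + 1"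
        then have n: "2 * q + 2 \<le> n" by simp
        \<comment> \<open>The part of the run that avoids both changed letters loses at most two letters.\<close>
        define i' where "i' = max i 1"
        define e where "e = min (i + n) (3 * p)"
        have "n - 2 \<le> e - i'" "1 \<le> i'" "i \<le> i'" "e \<le> i + n" "e \<le> 3 * p"
          using bnd q by (auto simp: i'_def e_def)
        have "i' \<le> e" using n bnd p3 by (auto simp: i'_def e_def)
        have "run ?w q i' (e - i')" by (rule run_subrun[OF r]) (use \<open>i \<le> i'\<close> \<open>e \<le> i + n\<close> \<open>i' \<le> e\<close> in auto)
        then have "e - i' \<le> 2 * q" by (rule no3) (use q 3 \<open>1 \<le> i'\<close> \<open>e \<le> 3 * p\<close> \<open>i' \<le> e\<close> in auto)
        then have "n = 2 * q + 2" "e - i' = n - 2" using n \<open>n - 2 \<le> e - i'\<close> by auto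
        then have "i = 0" "i + n = 3 * p + 1"
          using bnd n by (auto simp: i'_def e_def max_def min_def split: if_splits)
        then show False using \<open>n = 2 * q + 2\<close> 3 by linarith
      qed
      show ?thesis
      proof (cases "q = 1")
        case True
        have "n \<noteq> 3"
        proof
          assume "n = 3"
          have "\<not> (1 \<le> i \<and> i + n \<le> 3 * p)" using no3[OF r] True 3 \<open>n = 3\<close> by auto
          then consider "i = 0" | "i = 3 * p - 2" using bnd \<open>n = 3\<close> by linarith
          then show False
          proof cases
            case 1
            then have "?w ! 1 = ?w ! 2" using runD[OF r, of 1] True \<open>n = 3\<close> by (simp add: numeral_eq_Suc)
            then show False using w[of 1] w[of 2] s5 p3 by (simp add: numeral_eq_Suc)
          next
            case 2
            then have "?w ! (3 * p - 2) = ?w ! (3 * p - 1)"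
              using runD[OF r, of "3 * p - 2"] True \<open>n = 3\<close> p3 by (simp add: Suc_diff_Suc numeral_eq_Suc)
            moreover have "?w ! (3 * p - 2) = s ! (3 * p - 2 + 2)" by (rule w) (use p3 in auto)
            moreover have "?w ! (3 * p - 1) = s ! (3 * p - 1 + 2)" by (rule w) (use p3 in auto)
            moreover have "3 * p - 2 + 2 = 3 * p" "3 * p - 1 + 2 = 3 * p + 1" using p3 by simp_all
            ultimately have "s ! (3 * p) = s ! (3 * p + 1)" by metis
            moreover have "s ! (3 * p) = s ! 0" "s ! (3 * p + 1) = s ! 1"
              using sp3[of 0] sp3[of 1] p3 by simp_all
            ultimately show False using s5 by simp
          qed
        qed
        then have "n \<le> 2" using n2 True by simp
        then have "n * p \<le> 2 * p" by simp
        also have "\<dots> \<le> 3 * p - 1" using p3 by linarith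
        finally show ?thesis using True by simp
      next
        case False
        then have "q = (q - 2) + 2" using q by linarith
        then obtain d where d: "q = d + 2" by blast
        obtain c where c: "p = c + 3" using p3 le_Suc_ex by (metis add.commute)
        have "n * p \<le> (2 * q + 1) * p" using n2 by (rule mult_le_mono1)
        also have "\<dots> \<le> (3 * p - 1) * q" unfolding d c by (simp add: algebra_simps)
        finally show ?thesis .
      qed
    qed
  qed
qed

lemma critical_word_3_pow: "\<exists>w. critical_word w (3 * (3 * 2 ^ n) - 1) (3 * 2 ^ n)"
proof -
  have "\<exists>s. seed (3 * 2 ^ n) s"
  proof (induction n)
    case (Suc n)
    then show ?case using seed_tm by (metis mult.left_commute power_Suc)
  qed (use seed_3 in auto)
  then show ?thesis using critical_word_seed by blast
qed

lemma critical_word_8_pow: "\<exists>w. critical_word w (3 * (8 * 2 ^ n) - 1) (8 * 2 ^ n)"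
proof -
  have "\<exists>s. seed (8 * 2 ^ n) s"
  proof (induction n)
    case (Suc n)
    then show ?case using seed_tm by (metis mult.left_commute power_Suc)
  qed (use seed_8 in auto)
  then show ?thesis using critical_word_seed by blast
qed

lemma critical_word_2: "\<exists>w. critical_word w 5 2"
  by (rule exI[of _ "[False, False, True, False, True, False, False]"], rule critical_checkD) code_simp

lemma critical_word_5: "\<exists>w. critical_word w 14 5"
  by (rule exI[of _ "[False, False, True, True, False, True, False, True, True, False, True, False, True, True,
    False, False]"], rule critical_checkD) code_simp

lemma critical_word_9: "\<exists>w. critical_word w 25 9"
  by (rule exI[of _ "[True, False, True, False, False, True, False, True, True, False, False, True, False, False,
    True, False, True, True, False, False, True, False, False, True, False, True, False]"],
      rule critical_checkD) code_simp

section \<open>No morphism of length three or six\<close>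

fun lcp :: "bool list \<Rightarrow> bool list \<Rightarrow> nat" where
  "lcp (x # xs) (y # ys) = (if x = y then Suc (lcp xs ys) else 0)"
| "lcp _ _ = 0"

lemma nth_lcp: "j < lcp xs ys \<Longrightarrow> xs ! j = ys ! j"
  by (induction xs ys arbitrary: j rule: lcp.induct) (auto simp: less_Suc_eq_0_disj split: if_splits)

lemma lcp_le: "lcp xs ys \<le> length xs" "lcp xs ys \<le> length ys"
  by (induction xs ys rule: lcp.induct) auto

text \<open>
  By this many letters the image of a run outgrows the images of its own letters, if \<open>u\<close> and \<open>v\<close> are the
  images of the two letters.
\<close>

definition margin :: "bool list \<Rightarrow> bool list \<Rightarrow> nat" where
  "margin u v = lcp u v + lcp (rev u) (rev v)"

text \<open>
  If \<open>\<alpha>\<close> exceeds the exponent of a critical word, then the word is \<open>\<alpha>\<close>-free, hence so is its image,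
  and the exponent of the image is larger because of the margin.
\<close>

lemma critical_word_climb:
  assumes h: "uniform_morphism k h" "free_morphism \<alpha> h" and m: "k \<le> 3 * margin (h [False]) (h [True])"
    and "0 < k" and crit: "\<exists>w. critical_word w L p" and low: "Exactly (real L / real p) < \<alpha>"
  shows "Exactly ((real L + 1 / 3) / real p) < \<alpha>"
proof -
  obtain w where c: "0 < p" "p \<le> L" "length w = L + 2" "run w p 1 L"
    and top: "\<And>q i n. 0 < q \<Longrightarrow> q \<le> n \<Longrightarrow> run w q i n \<Longrightarrow> n * p \<le> L * q"
    using crit unfolding critical_word_def by blast
  let ?u = "h [False]" and ?v = "h [True]"
  define a where "a = lcp ?u ?v"
  define s where "s = lcp (rev ?u) (rev ?v)"
  have len: "length (h [b]) = k" for b using h(1) by (simp add: uniform_morphism_def)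
  have as: "a \<le> k" "s \<le> k" using lcp_le[of ?u ?v] lcp_le[of "rev ?u" "rev ?v"] len by (auto simp: a_def s_def)
  have "free_word \<alpha> w"
    unfolding free_word_iff_run
  proof (intro allI impI)
    fix q i n assume q: "1 \<le> q \<and> q \<le> n \<and> run w q i n"
    then have "n * p \<le> L * q" using top by auto
    then have "real n * real p \<le> real L * real q" by (metis of_nat_le_iff of_nat_mult)
    then have "real n / real q \<le> real L / real p" using q c by (simp add: field_simps)
    then show "Exactly (real n / real q) < \<alpha>" using low Exactly_less_mono by blast
  qed
  then have free: "free_word \<alpha> (h w)" using h(2) by (simp add: free_morphism_def)
  have "h w = concat (map (\<lambda>b. h [b]) w)"
    using binary_morphism_eq_concat h(1) by (simp add: uniform_morphism_def)
  moreover have "run (concat (map (\<lambda>b. h [b]) w)) (k * p) (k * 1 - s) (k * L + a + s)"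
  proof (rule run_concat_uniform[OF len c(4) \<open>0 < k\<close>])
    show "h [b] ! l = h [b'] ! l" if "l < a" for l b b'
      using nth_lcp[of l ?u ?v] that by (cases b; cases b') (auto simp: a_def)
    show "h [b] ! l = h [b'] ! l" if "k - s \<le> l" "l < k" for l b b'
    proof -
      have "rev ?u ! (k - 1 - l) = rev ?v ! (k - 1 - l)"
        by (rule nth_lcp) (use that as in \<open>auto simp: s_def\<close>)
      moreover have "k - 1 - l < k" "k - Suc (k - 1 - l) = l" using that by auto
      ultimately have "?u ! l = ?v ! l" by (simp add: rev_nth len)
      then show ?thesis by (cases b; cases b') auto
    qed
  qed (use as c in \<open>auto simp: algebra_simps\<close>)
  ultimately have r: "run (h w) (k * p) (k * 1 - s) (k * L + a + s)" by simp
  have "Exactly (real (k * L + a + s) / real (k * p)) < \<alpha>"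
  proof (rule free_wordD[OF free r])
    show "1 \<le> k * p" using c \<open>0 < k\<close> by simp
    show "k * p \<le> k * L + a + s" using mult_le_mono2[OF c(2), of k] by linarith
  qed
  moreover have "(real L + 1 / 3) / real p \<le> real (k * L + a + s) / real (k * p)"
  proof -
    have "real k \<le> real (3 * (a + s))"
      using m unfolding margin_def a_def s_def by (simp only: of_nat_le_iff)
    then have "real k * (real L + 1 / 3) \<le> real k * real L + real a + real s" by (simp add: algebra_simps)
    then have "real k * (real L + 1 / 3) / (real k * real p) \<le> (real k * real L + real a + real s) / (real k * real p)"
      by (intro divide_right_mono) auto
    then show ?thesis using \<open>0 < k\<close> by simp
  qed
  ultimately show ?thesis using Exactly_less_mono by blast
qed

text \<open>
  Critical words whose exponents are spaced densely enough push \<open>\<alpha>\<close> up to \<open>3\<close>. A critical word whose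
  run has period \<open>p\<close> and length \<open>3 * p - 1\<close> raises the lower bound from \<open>3 - 1 / p\<close> to
  \<open>3 - 2 / (3 * p)\<close>, and the exponent of the next word must not exceed that; so consecutive periods may grow by a factor of at most \<open>3 / 2\<close>. The
  periods \<open>8, 12, 16, 24, \<dots>\<close>, alternately \<open>8 * 2 ^ m\<close> and \<open>12 * 2 ^ m\<close>, satisfy this. Below
  \<open>23 / 8\<close>, words with the exponents \<open>5/2\<close>, \<open>8/3\<close>, \<open>25/9\<close>, \<open>14/5\<close> and \<open>17/6\<close> bridge the gap; the
  word of period nine is there because there is no critical word for period four and length eleven.
\<close>

lemma wide_margin_not_free:
  assumes h: "uniform_morphism k h" "free_morphism \<alpha> h" "k \<le> 3 * margin (h [False]) (h [True])" "0 < k"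
    and low: "Exactly (5 / 2) < \<alpha>"
  shows "\<not> \<alpha> < Exactly 3"
proof
  assume "\<alpha> < Exactly 3"
  note climb = critical_word_climb[OF h]
  have "Exactly (8 / 3) < \<alpha>" using climb[OF critical_word_2] low by simp
  then have "Exactly (25 / 9) < \<alpha>" using climb[OF critical_word_3_pow[of 0]] by simp
  then have "Exactly (76 / 27) < \<alpha>" using climb[OF critical_word_9] by simp
  then have "Exactly (14 / 5) < \<alpha>" by (rule Exactly_less_mono) simp
  then have "Exactly (43 / 15) < \<alpha>" using climb[OF critical_word_5] by simp
  then have "Exactly (17 / 6) < \<alpha>" by (rule Exactly_less_mono) simp
  then have "Exactly (26 / 9) < \<alpha>" using climb[OF critical_word_3_pow[of 1]] by simp
  then have base: "Exactly (23 / 8) < \<alpha>" by (rule Exactly_less_mono) simp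
  have all: "Exactly (3 - 1 / (8 * 2 ^ m)) < \<alpha>" for m
  proof (induction m)
    case 0
    then show ?case using base by simp
  next
    case (Suc m)
    define x :: real where "x = 2 ^ m"
    have "x \<ge> 1" by (simp add: x_def)
    have L1: "real (3 * (8 * 2 ^ m) - 1) = 24 * x - 1"
      by (subst of_nat_diff) (simp_all add: x_def)
    have L2: "real (3 * (3 * 2 ^ (m + 2)) - 1) = 36 * x - 1"
      by (subst of_nat_diff) (simp_all add: x_def power_add)
    have P: "real (8 * 2 ^ m) = 8 * x" "real (3 * 2 ^ (m + 2)) = 12 * x" by (simp_all add: x_def power_add)
    have "Exactly (real (3 * (8 * 2 ^ m) - 1) / real (8 * 2 ^ m)) < \<alpha>"
      unfolding L1 P by (rule Exactly_less_mono[OF Suc]) (use \<open>x \<ge> 1\<close> in \<open>simp add: field_simps flip: x_def\<close>)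
    from climb[OF critical_word_8_pow this]
    have "Exactly ((24 * x - 1 + 1 / 3) / (8 * x)) < \<alpha>" unfolding L1 P .
    then have "Exactly (real (3 * (3 * 2 ^ (m + 2)) - 1) / real (3 * 2 ^ (m + 2))) < \<alpha>"
      unfolding L2 P by (rule Exactly_less_mono) (use \<open>x \<ge> 1\<close> in \<open>simp add: field_simps\<close>)
    from climb[OF critical_word_3_pow this]
    have "Exactly ((36 * x - 1 + 1 / 3) / (12 * x)) < \<alpha>" unfolding L2 P .
    then show ?case
      by (rule Exactly_less_mono) (use \<open>x \<ge> 1\<close> in \<open>simp add: field_simps flip: x_def\<close>)
  qed
  \<comment> \<open>Here \<open>a\<close> is the real number underlying \<open>\<alpha>\<close>, which lies strictly below \<open>3\<close> also if \<open>\<alpha> = Above a\<close>.\<close>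
  obtain a where a: "a < 3" "\<And>x. Exactly x < \<alpha> \<Longrightarrow> x \<le> a"
    using \<open>\<alpha> < Exactly 3\<close> by (cases \<alpha>) auto
  obtain m where "(1 / 2) ^ m < 3 - a" using real_arch_pow_inv[of "3 - a" "1 / 2"] a by auto
  moreover have "3 - 1 / (8 * 2 ^ m) \<le> a" using a all by blast
  moreover have "1 / (8 * 2 ^ m) \<le> (1 / 2 :: real) ^ m" by (simp add: power_one_over field_simps)
  ultimately show False by linarith
qed

lemma square_in_four_letters:
  assumes "4 \<le> length w" shows "\<exists>p i. 0 < p \<and> run w p i (2 * p)"
proof -
  \<comment> \<open>Two adjacent letters are equal, or the four letters alternate.\<close>
  obtain a b c d v where w: "w = a # b # c # d # v"
    using assms by (auto simp: Suc_le_length_iff numeral_eq_Suc)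
  show ?thesis
  proof (cases "a = b \<or> b = c \<or> c = d")
    case True
    then have "run w 1 0 2 \<or> run w 1 1 2 \<or> run w 1 2 2" by (auto simp: w run_def less_Suc_eq numeral_eq_Suc)
    then obtain i where "run w 1 i (2 * 1)" by auto
    then show ?thesis by (intro exI[of _ "1 :: nat"] exI[of _ i]) simp
  next
    case False
    then have "run w 2 0 (2 * 2)" by (auto simp: w run_def less_Suc_eq numeral_eq_Suc)
    then show ?thesis by (intro exI[of _ "2 :: nat"] exI[of _ "0 :: nat"]) simp
  qed
qed

text \<open>
  The word \<open>01\<close> has critical exponent one, and its image is long enough to contain a square.
\<close>

lemma free_morphism_gt_2:
  assumes "uniform_morphism k h" "2 \<le> k" "free_morphism \<alpha> h" "Exactly 1 < \<alpha>"
  shows "Exactly 2 < \<alpha>"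
proof -
  have "free_word \<alpha> [False, True]"
    unfolding free_word_iff_run
  proof (intro allI impI)
    fix q i n assume q: "1 \<le> q \<and> q \<le> n \<and> run [False, True] q i n"
    have "n \<le> q"
    proof (rule ccontr)
      assume "\<not> n \<le> q"
      then have "q = 1" "i = 0" "n = 2" using q run_length[of "[False, True]" q i n] by auto
      then show False using q runD[of "[False, True]" 1 0 2 0] by simp
    qed
    then have "real n / real q = 1" using q by simp
    then show "Exactly (real n / real q) < \<alpha>" using assms by simp
  qed
  then have f: "free_word \<alpha> (h [False, True])" using assms by (simp add: free_morphism_def)
  have "h [False, True] = h [False] @ h [True]"
    using assms(1) unfolding uniform_morphism_def binary_morphism_def by (metis append_Cons append_Nil)
  then have "4 \<le> length (h [False, True])" using assms by (simp add: uniform_morphism_def)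
  then obtain p i where p: "0 < p" "run (h [False, True]) p i (2 * p)" using square_in_four_letters by blast
  have "Exactly (real (2 * p) / real p) < \<alpha>" by (rule free_wordD[OF f p(2)]) (use p in auto)
  then show ?thesis using p by simp
qed

lemma free_word_overlap_free:
  assumes "overlap_free w" "Exactly 2 < \<alpha>" shows "free_word \<alpha> w"
  unfolding free_word_iff_run
proof (intro allI impI)
  fix q i n assume q: "1 \<le> q \<and> q \<le> n \<and> run w q i n"
  have "n \<le> 2 * q"
  proof (rule ccontr)
    assume n: "\<not> n \<le> 2 * q"
    have "run w q i (2 * q + 1)" by (rule run_subrun[of w q i n]) (use q n in auto)
    then show False using assms(1) q by (auto simp: overlap_free_def)
  qed
  then have "real n / real q \<le> 2" using q by (simp add: field_simps)
  then show "Exactly (real n / real q) < \<alpha>" using assms Exactly_less_mono by blast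
qed

definition has_cube :: "bool list \<Rightarrow> bool" where
  "has_cube w \<longleftrightarrow> (\<exists>p\<in>set [1..<Suc (length w div 3)]. has_run w p (2 * p))"

definition has_five_halves :: "bool list \<Rightarrow> bool" where
  "has_five_halves w \<longleftrightarrow> (\<exists>p\<in>set [1..<length w]. has_run w p ((3 * p + 1) div 2))"

text \<open>
  For the images \<open>u\<close> and \<open>v\<close> of the two letters, the words \<open>u u\<close>, \<open>v v\<close> and \<open>u v v u\<close> are the images of the
  overlap-free words \<open>00\<close>, \<open>11\<close> and \<open>0110\<close>. A cube in one of them rules out every \<open>\<alpha> < 3\<close> at once; in
  the remaining case \<open>\<alpha>\<close> is pushed above \<open>5 / 2\<close>, and the margin does the rest.
\<close>

definition doomed_pair :: "bool list \<Rightarrow> bool list \<Rightarrow> bool" where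
  "doomed_pair u v \<longleftrightarrow> has_cube (u @ u) \<or> has_cube (v @ v) \<or> has_cube (u @ v @ v @ u) \<or>
     length u \<le> 3 * margin u v \<and> has_five_halves (u @ v @ v @ u)"

text \<open>
  The case \<open>has_cube (u @ u)\<close> is repeated outside the inner quantifier only to cut the search short.
\<close>

lemma doomed_pairs_3:
  "\<forall>u\<in>set (List.n_lists 3 [False, True]). has_cube (u @ u) \<or>
     (\<forall>v\<in>set (List.n_lists 3 [False, True]). doomed_pair u v)"
  by code_simp

lemma doomed_pairs_6:
  "\<forall>u\<in>set (List.n_lists 6 [False, True]). has_cube (u @ u) \<or>
     (\<forall>v\<in>set (List.n_lists 6 [False, True]). doomed_pair u v)"
  by code_simp

lemma has_cubeD:
  assumes "has_cube w" obtains p i where "0 < p" "run w p i (3 * p)"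
proof -
  obtain p where "p \<in> set [1..<Suc (length w div 3)]" and p: "has_run w p (2 * p)"
    using assms unfolding has_cube_def by blast
  then have "0 < p" "p \<le> length w" by auto
  then obtain i where "run w p i (2 * p + p)" using p has_run_iff_run[of p w "2 * p"] by auto
  moreover have "2 * p + p = 3 * p" by simp
  ultimately show ?thesis using that \<open>0 < p\<close> by metis
qed

lemma has_five_halvesD:
  assumes "has_five_halves w" obtains p i n where "0 < p" "p \<le> n" "5 * p \<le> 2 * n" "run w p i n"
proof -
  obtain p where "p \<in> set [1..<length w]" and run: "has_run w p ((3 * p + 1) div 2)"
    using assms unfolding has_five_halves_def by blast
  then have p: "0 < p" "p < length w" by auto
  with run obtain i where "run w p i ((3 * p + 1) div 2 + p)"
    using has_run_iff_run[of p w] by auto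
  moreover have "5 * p \<le> 2 * ((3 * p + 1) div 2 + p)" by presburger
  ultimately show ?thesis using that p by (metis le_add2)
qed

lemma not_free_length_3_6:
  assumes \<alpha>: "Exactly 1 < \<alpha>" "\<alpha> < Exactly 3" and k: "k \<in> {3, 6}"
    and h: "uniform_morphism k h" "free_morphism \<alpha> h"
  shows False
proof -
  let ?u = "h [False]" and ?v = "h [True]"
  have \<alpha>2: "Exactly 2 < \<alpha>" using free_morphism_gt_2[OF h(1) _ h(2) \<alpha>(1)] k by auto
  have len: "length ?u = k" "length ?v = k" using h(1) by (simp_all add: uniform_morphism_def)
  have img: "h w = concat (map (\<lambda>b. h [b]) w)" for w
    using binary_morphism_eq_concat h(1) by (simp add: uniform_morphism_def)
  have no_cube: "\<not> has_cube (h w)" if "overlap_free w" for w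
  proof
    assume "has_cube (h w)"
    then obtain p i where p: "0 < p" "run (h w) p i (3 * p)" by (rule has_cubeD)
    have "free_word \<alpha> (h w)"
      using free_word_overlap_free[OF that \<alpha>2] h(2) by (simp add: free_morphism_def)
    then have "Exactly (real (3 * p) / real p) < \<alpha>" by (rule free_wordD[OF _ p(2)]) (use p in auto)
    then have "Exactly 3 < \<alpha>" using p by simp
    then show False using \<alpha>(2) by simp
  qed
  have of2: "overlap_free [c, b]" for b c using overlap_free_tmw[of 0 c b] by (simp add: tmw_0)
  have of4: "overlap_free [False, True, True, False]"
    using tm_overlap_free[OF of2[of False True]] by (simp add: tm_Cons)
  have "doomed_pair ?u ?v"
  proof -
    have "?u \<in> set (List.n_lists k [False, True])" "?v \<in> set (List.n_lists k [False, True])"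
      using len by (simp_all only: n_lists_bool)
    moreover have "k = 3 \<or> k = 6" using k by simp
    ultimately have "has_cube (?u @ ?u) \<or> doomed_pair ?u ?v"
      using doomed_pairs_3 doomed_pairs_6 by blast
    then show ?thesis unfolding doomed_pair_def by blast
  qed
  moreover have "\<not> has_cube (?u @ ?u)" "\<not> has_cube (?v @ ?v)" "\<not> has_cube (?u @ ?v @ ?v @ ?u)"
    using no_cube[OF of2[of False False]] no_cube[OF of2[of True True]] no_cube[OF of4]
      img[of "[False, False]"] img[of "[True, True]"] img[of "[False, True, True, False]"] by simp_all
  ultimately have m: "k \<le> 3 * margin ?u ?v" and five: "has_five_halves (h [False, True, True, False])"
    using len img[of "[False, True, True, False]"] by (simp_all add: doomed_pair_def)
  from five obtain p i n where p: "0 < p" "p \<le> n" "5 * p \<le> 2 * n" "run (h [False, True, True, False]) p i n"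
    by (rule has_five_halvesD)
  have "free_word \<alpha> (h [False, True, True, False])"
    using free_word_overlap_free[OF of4 \<alpha>2] h(2) by (simp add: free_morphism_def)
  then have "Exactly (real n / real p) < \<alpha>" by (rule free_wordD[OF _ p(4)]) (use p in auto)
  moreover have "5 / 2 \<le> real n / real p" using p by (simp add: field_simps)
  ultimately have "Exactly (5 / 2) < \<alpha>" by (rule Exactly_less_mono)
  moreover have "0 < k" using k by auto
  ultimately show False using wide_margin_not_free[OF h m] \<alpha>(2) by blast
qed

theorem theorem9:
  shows "(\<forall>\<alpha> :: rhat. Exactly 1 < \<alpha> \<and> \<alpha> < Exactly 3 \<longrightarrow>
            \<not> (\<exists>h. uniform_morphism 3 h \<and> free_morphism \<alpha> h) \<and>
            \<not> (\<exists>h. uniform_morphism 6 h \<and> free_morphism \<alpha> h))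
       \<and> (\<forall>k :: nat. 0 < k \<and> k \<notin> {3, 6} \<longrightarrow>
            (\<exists>h. complementary_morphism h \<and> uniform_morphism k h \<and>
                 (\<exists>\<alpha> :: rhat. Exactly 1 < \<alpha> \<and> \<alpha> < Exactly 3 \<and> free_morphism \<alpha> h)))"
proof (intro conjI allI impI)
  fix \<alpha> :: rhat assume "Exactly 1 < \<alpha> \<and> \<alpha> < Exactly 3"
  then show "\<not> (\<exists>h. uniform_morphism 3 h \<and> free_morphism \<alpha> h)"
    "\<not> (\<exists>h. uniform_morphism 6 h \<and> free_morphism \<alpha> h)"
    using not_free_length_3_6[of \<alpha> 3] not_free_length_3_6[of \<alpha> 6] by auto
next
  fix k :: nat assume "0 < k \<and> k \<notin> {3, 6}"
  then obtain h a0 where h: "complementary_morphism h" "uniform_morphism k h" "a0 < 3"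
    and free: "\<And>a. a0 \<le> a \<Longrightarrow> a < 3 \<Longrightarrow> free_morphism (Exactly a) h"
    using good_length_all[of k] unfolding good_length_def by auto
  define a where "a = max a0 2"
  have "Exactly 1 < Exactly a" "Exactly a < Exactly 3" using h(3) by (auto simp: a_def)
  moreover have "free_morphism (Exactly a) h" using free h(3) by (auto simp: a_def)
  ultimately show "\<exists>h. complementary_morphism h \<and> uniform_morphism k h \<and>
      (\<exists>\<alpha> :: rhat. Exactly 1 < \<alpha> \<and> \<alpha> < Exactly 3 \<and> free_morphism \<alpha> h)"
    using h by blast
qed

end
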